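(* Let $\Lambda$ be a finite set. If $W\subseteq\Lambda^{\mathbb{N}_0^2}$ is an RLP subshift and $\mu$ is an atom-less invariant Borel probability measure on it, then, with $\mathcal{B}$ the Borel $\sigma$-algebra of $W$, the function $x\mapsto\mu_x^{\sigma_{(1,0)}^{-1}\mathcal{B}}(\{x\})$ is $\sigma_{(0,1)}$-invariant ($\mu$-almost-surely), measurable with respect to the Pinsker $\sigma$-algebras of both maps $\sigma_{(1,0)}$ and $\sigma_{(0,1)}$ (which are equal), and, when $\mu_x^{\sigma_{(1,0)}^{-1}\mathcal{B}}$ is considered as a probability measure on $\Lambda$, it is $\mu$-almost-surely the uniform probability on a subset $\Lambda_{\mu,x}\subseteq\Lambda$.
   Context: $\mathbb{N}_0$ is the set of non-negative integers. On $\Lambda^{\mathbb{N}_0^2}$, $\sigma_{(i,j)}$ is the shift $(\sigma_{(i,j)}(x))_{m,n}=x_{m+i,n+j}$. A two-dimensional subshift $W\subseteq\Lambda^{\mathbb{N}_0^2}$ is a closed shift-invariant subset; it is always implicitly assumed that $\sigma_{(1,0)}:W\to W$ and $\sigma_{(0,1)}:W\to W$ are onto. A measure on $W$ is invariant if it is invariant under both $\sigma_{(1,0)}$ and $\sigma_{(0,1)}$. $(1,0)$ almost-generates $W$ if $W$ is uncountable and, outside of some countable set of points of $W$, the values of a point at the indices $\{(m,0)\}_{m\in\mathbb{N}_0}$ (row zero) determine its values at the rest of the indices. In that case such a countable set can be taken to be $C_W$, the set of all points of $W$ whose zero row is shared with some other point of $W$. Almost-generation by $(0,1)$ is defined similarly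 with the indices $\{(0,m)\}_{m\in\mathbb{N}_0}$. If $W$ is almost-generated by $(1,0)$, the almost-generation is done in a left permutative manner if, outside of $C_W$, the function by which the values at the indices $\{(m,0)\}_{m\in\mathbb{N}_0}$ determine the value at $(0,1)$ changes value whenever the value at $(0,0)$ is changed; that is, if $x,y\in W\setminus C_W$ satisfy $x_{m,0}=y_{m,0}$ for all $m\ge1$ and $x_{0,0}\ne y_{0,0}$, then $x_{0,1}\neq y_{0,1}$. Let $\xi$ be the partition of $W$ according to the value at $(0,0)$. $W$ is reciprocal if it is almost-generated by both $(1,0)$ and $(0,1)$ and there exists a real $a>0$ such that the maximal number of elements of $\bigvee_{i=0}^{\lfloor al\rfloor}\sigma_{(0,1)}^{-i}\xi$ that any element of $\bigvee_{i=0}^{l}\sigma_{(1,0)}^{-i}\xi$ intersects is asymptotically sub-exponential in $l$ (i.e. $o(e^{\lambda l})$ for all $\lambda>0$), and the maximal number of elements of $\bigvee_{i=0}^{l}\sigma_{(1,0)}^{-i}\xi$ that any element of $\bigvee_{i=0}^{\lfloor al\rfloor}\sigma_{(0,1)}^{-i}\xi$ intersects is also asymptotically sub-exponential in $l$. $W$ is an RLP subshift if it is reciprocal and the almost-generation by $(1,0)$ is done in a left permutative manner. $\mu_x^{\mathcal{A}}$ is the conditional probability measure of $\mu$ with respect to a sub-$\sigma$-algebra $\mathcal{A}$ at $x$. The measure $\mu_x^{\sigma_{(1,0)}^{-1}\mathcal{B}}$ is considered as a measure on $\Lambda$ through $y\mapsto y_{0,0}$ (since $\mu$ is atom-less, $\mu$-almost-surely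 row zero determines the whole point, so within the atom of $x$ in $\sigma_{(1,0)}^{-1}\mathcal{B}$ a point is $\mu$-almost-surely determined by its value at $(0,0)$). $\sigma$-algebras are understood modulo $\mu$-null sets. *)

theory Defs
  imports "HOL-Probability.Probability" "HOL-Library.Landau_Symbols"
begin

section \<open>Two-dimensional subshifts\<close>

type_synonym 'a config = "nat \<times> nat \<Rightarrow> 'a"

definition shift :: "nat \<times> nat \<Rightarrow> 'a config \<Rightarrow> 'a config" where
  "shift v x = (\<lambda>(m, n). x (m + fst v, n + snd v))"

definition full_shift_topology :: "'a set \<Rightarrow> 'a config topology" where
  "full_shift_topology \<Lambda> = product_topology (\<lambda>_. discrete_topology \<Lambda>) UNIV"

text \<open>Following the standing convention, surjectivity of the two generating shifts is part of
  the notion.\<close>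

definition subshift :: "'a set \<Rightarrow> 'a config set \<Rightarrow> bool" where
  "subshift \<Lambda> W \<longleftrightarrow>
     closedin (full_shift_topology \<Lambda>) W \<and>
     (\<forall>v. shift v ` W \<subseteq> W) \<and>
     shift (1, 0) ` W = W \<and> shift (0, 1) ` W = W"

definition row_zero :: "(nat \<times> nat) set" where
  "row_zero = range (\<lambda>m. (m, 0))"

definition column_zero :: "(nat \<times> nat) set" where
  "column_zero = range (\<lambda>m. (0, m))"

definition almost_generated :: "(nat \<times> nat) set \<Rightarrow> 'a config set \<Rightarrow> bool" where
  "almost_generated I W \<longleftrightarrow>
     uncountable W \<and>
     (\<exists>C\<subseteq>W. countable C \<and> (\<forall>x\<in>W - C. \<forall>y\<in>W - C. (\<forall>i\<in>I. x i = y i) \<longrightarrow> x = y))"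

text \<open>The exceptional set \<open>C\<^sub>W\<close>.\<close>

definition shared_row_set :: "'a config set \<Rightarrow> 'a config set" where
  "shared_row_set W = {x \<in> W. \<exists>y\<in>W. y \<noteq> x \<and> (\<forall>i\<in>row_zero. y i = x i)}"

definition left_permutative :: "'a config set \<Rightarrow> bool" where
  "left_permutative W \<longleftrightarrow>
     (\<forall>x \<in> W - shared_row_set W. \<forall>y \<in> W - shared_row_set W.
        (\<forall>m\<ge>1. x (m, 0) = y (m, 0)) \<and> x (0, 0) \<noteq> y (0, 0) \<longrightarrow> x (0, 1) \<noteq> y (0, 1))"

section \<open>Partitions, reciprocal and RLP subshifts\<close>

text \<open>The join of \<open>T\<^sup>-\<^sup>iP\<close> over \<open>0 \<le> i < n\<close> (so \<open>n\<close> is the number of partitions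
  joined, not the last exponent); empty intersections are not elements of it.\<close>

definition iterated_join ::
    "'x set \<Rightarrow> ('x \<Rightarrow> 'x) \<Rightarrow> 'x set set \<Rightarrow> nat \<Rightarrow> 'x set set" where
  "iterated_join X T P n =
     {A. \<exists>p. (\<forall>i<n. p i \<in> P) \<and> A = {x \<in> X. \<forall>i<n. (T ^^ i) x \<in> p i}} - {{}}"

definition zero_partition :: "'a config set \<Rightarrow> 'a config set set" where
  "zero_partition W = (\<lambda>x. {y \<in> W. y (0, 0) = x (0, 0)}) ` W"

definition max_intersections :: "'x set set \<Rightarrow> 'x set set \<Rightarrow> nat" where
  "max_intersections P Q = Max ((\<lambda>p. card {q \<in> Q. p \<inter> q \<noteq> {}}) ` P)"

definition subexponential :: "(nat \<Rightarrow> nat) \<Rightarrow> bool" where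
  "subexponential f \<longleftrightarrow> (\<forall>c>0. (\<lambda>l. real (f l)) \<in> o(\<lambda>l. exp (c * real l)))"

definition reciprocal :: "'a config set \<Rightarrow> bool" where
  "reciprocal W \<longleftrightarrow>
     almost_generated row_zero W \<and> almost_generated column_zero W \<and>
     (\<exists>a::real. a > 0 \<and>
        (let H = (\<lambda>l. iterated_join W (shift (1, 0)) (zero_partition W) (l + 1));
             V = (\<lambda>l. iterated_join W (shift (0, 1)) (zero_partition W) (nat \<lfloor>a * real l\<rfloor> + 1))
         in subexponential (\<lambda>l. max_intersections (H l) (V l)) \<and>
            subexponential (\<lambda>l. max_intersections (V l) (H l))))"

definition rlp_subshift :: "'a set \<Rightarrow> 'a config set \<Rightarrow> bool" where
  "rlp_subshift \<Lambda> W \<longleftrightarrow> subshift \<Lambda> W \<and> reciprocal W \<and> left_permutative W"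

section \<open>Invariant measures, Pinsker algebras, conditional measures\<close>

definition subshift_borel :: "'a set \<Rightarrow> 'a config set \<Rightarrow> 'a config measure" where
  "subshift_borel \<Lambda> W = sigma W {U. openin (subtopology (full_shift_topology \<Lambda>) W) U}"

definition invariant_measure :: "'x measure \<Rightarrow> ('x \<Rightarrow> 'x) \<Rightarrow> bool" where
  "invariant_measure M T \<longleftrightarrow> T \<in> measurable M M \<and> distr M M T = M"

text \<open>On the standard Borel spaces used here every atom is carried by a point.\<close>

definition atomless :: "'x measure \<Rightarrow> bool" where
  "atomless M \<longleftrightarrow> (\<forall>x\<in>space M. emeasure M {x} = 0)"

definition partition_entropy :: "'x measure \<Rightarrow> 'x set set \<Rightarrow> real" where
  "partition_entropy M P = - (\<Sum>A\<in>P. measure M A * ln (measure M A))"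

definition dynamical_entropy :: "'x measure \<Rightarrow> ('x \<Rightarrow> 'x) \<Rightarrow> 'x set set \<Rightarrow> real" where
  "dynamical_entropy M T P =
     lim (\<lambda>n. partition_entropy M (iterated_join (space M) T P n) / real n)"

text \<open>Null sets of \<open>M\<close> span partitions of zero entropy, so this \<open>\<sigma>\<close>-algebra contains them all.\<close>

definition pinsker_algebra :: "'x measure \<Rightarrow> ('x \<Rightarrow> 'x) \<Rightarrow> 'x measure" where
  "pinsker_algebra M T =
     sigma (space M) {A \<in> sets M. dynamical_entropy M T {A, space M - A} = 0}"

text \<open>\<open>\<kappa>\<close> is a version of the conditional measures \<open>\<mu>\<^sub>x\<close> of \<open>M\<close> with respect to the
  sub-\<open>\<sigma>\<close>-algebra given by \<open>F\<close>.\<close>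

definition conditional_measures ::
    "'x measure \<Rightarrow> 'x measure \<Rightarrow> ('x \<Rightarrow> 'x measure) \<Rightarrow> bool" where
  "conditional_measures M F \<kappa> \<longleftrightarrow>
     subalgebra M F \<and>
     \<kappa> \<in> measurable F (prob_algebra M) \<and>
     (\<forall>B\<in>sets M. AE x in M. measure (\<kappa> x) B = real_cond_exp M F (indicator B) x)"

end

theory Submission
  imports Defs
begin

text \<open>
  Write \<open>T\<close> and \<open>S\<close> for the horizontal and the vertical shift and \<open>f x = \<mu>\<^sub>x({x})\<close>. An event of zero
  \<open>T\<close>-entropy lies in \<open>T\<^sup>-\<^sup>n\<B>\<close> modulo null sets for all \<open>n\<close>. Conversely, if \<open>A\<close> is such a tail event
  for \<open>T\<close>, so are all \<open>S\<^sup>-\<^sup>iA\<close>, and conditioning on them does not lower the entropy of the first \<open>l\<close>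
  horizontal coordinates beyond \<open>l\<close> times its rate; by reciprocity these coordinates carry, up to
  \<open>o(l)\<close>, the same information as the first \<open>\<lfloor>al\<rfloor>\<close> vertical ones, which leaves no room for \<open>A\<close> to have
  positive \<open>S\<close>-entropy. Exchanging the roles, both Pinsker algebras and both tails coincide.

  Given \<open>T x\<close>, left permutativity makes \<open>x (0, 1)\<close> determine \<open>x (0, 0)\<close>, hence \<open>x\<close>. So \<open>f x\<close> is the
  conditional probability of the symbol \<open>x (0, 1)\<close> given \<open>T\<^sup>-\<^sup>1\<B>\<close>, whereas \<open>f (S x)\<close> is that given the
  smaller algebra \<open>S\<^sup>-\<^sup>1T\<^sup>-\<^sup>1\<B>\<close>. Both have the same integral, and the equality case of Jensen's inequality
  for the square gives \<open>f \<circ> S = f\<close>. Thus the level sets of \<open>f\<close> have zero \<open>S\<close>-entropy, so they belong to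
  the tail of \<open>T\<close>; hence \<open>f\<close> is constant on the fibres of \<open>T\<close>, that is, the fibre measures are uniform.
\<close>

section \<open>Entropy of simple functions\<close>

context information_space
begin

\<comment> \<open>The library notation with \<open>|\<close> is ambiguous with disjunction.\<close>
no_notation conditional_entropy_Pow (\<open>\<H>'(_ | _')\<close>)
notation conditional_entropy_Pow (\<open>\<H>'(_ \<bar> _')\<close>)

text \<open>Values that do not occur contribute 0, so the range may be enlarged to any finite
  superset. This lets variables with different ranges be compared term by term.\<close>

lemma entropy_eq_sum:
  assumes X: "simple_function M X" and A: "finite A" "X ` space M \<subseteq> A"
  shows "\<H>(X) = - (\<Sum>v\<in>A. prob (X -` {v} \<inter> space M) * log b (prob (X -` {v} \<inter> space M)))"
proof -
  have "\<H>(X) = - (\<Sum>v\<in>X ` space M. prob (X -` {v} \<inter> space M) * log b (prob (X -` {v} \<inter> space M)))"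
    by (rule entropy_simple_distributed[OF simple_distributedI[OF X measure_nonneg refl]])
  also have "(\<Sum>v\<in>X ` space M. prob (X -` {v} \<inter> space M) * log b (prob (X -` {v} \<inter> space M)))
      = (\<Sum>v\<in>A. prob (X -` {v} \<inter> space M) * log b (prob (X -` {v} \<inter> space M)))"
  proof (rule sum.mono_neutral_left[OF A(1) A(2)], intro ballI)
    fix v assume "v \<in> A - X ` space M"
    then have "X -` {v} \<inter> space M = {}" by auto
    then show "prob (X -` {v} \<inter> space M) * log b (prob (X -` {v} \<inter> space M)) = 0" by simp
  qed
  finally show ?thesis .
qed

lemma entropy_eq_if_same_law:
  assumes X: "simple_function M X" and Y: "simple_function M Y"
    and eq: "\<And>v. prob (X -` {v} \<inter> space M) = prob (Y -` {v} \<inter> space M)"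
  shows "\<H>(X) = \<H>(Y)"
proof -
  have fin: "finite (X ` space M \<union> Y ` space M)"
    using X Y by (auto simp: simple_function_def)
  show ?thesis
    by (simp add: entropy_eq_sum[OF X fin] entropy_eq_sum[OF Y fin] eq)
qed

lemma entropy_cong_AE:
  assumes X: "simple_function M X" and Y: "simple_function M Y"
    and eq: "AE x in M. X x = Y x"
  shows "\<H>(X) = \<H>(Y)"
proof (rule entropy_eq_if_same_law[OF X Y])
  fix v
  show "prob (X -` {v} \<inter> space M) = prob (Y -` {v} \<inter> space M)"
    by (rule measure_eq_AE) (use eq X Y in \<open>auto intro: simple_functionD\<close>)
qed

text \<open>\<open>X\<close> factors through \<open>Y\<close>, and applying a function cannot raise
  entropy. As the hypothesis concerns points, later comparisons of entropies reduce to implications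
  between equalities of words.\<close>

lemma entropy_determined:
  assumes X: "simple_function M X" and Y: "simple_function M Y"
    and det: "\<And>x y. x \<in> space M \<Longrightarrow> y \<in> space M \<Longrightarrow> Y x = Y y \<Longrightarrow> X x = X y"
  shows "\<H>(X) \<le> \<H>(Y)"
proof -
  define g where "g = X \<circ> inv_into (space M) Y"
  have g: "g (Y x) = X x" if "x \<in> space M" for x
    unfolding g_def comp_def
    by (rule det) (use that in \<open>auto intro: inv_into_into f_inv_into_f\<close>)
  have "\<H>(X) = \<H>(g \<circ> Y)"
    by (rule entropy_cong_AE[OF X simple_function_compose[OF Y]]) (auto simp: g)
  also have "\<dots> \<le> \<H>(Y)"
    by (rule entropy_data_processing[OF Y])
  finally show ?thesis .
qed

lemma entropy_determined_eq:
  assumes "simple_function M X" and "simple_function M Y"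
    and "\<And>x y. x \<in> space M \<Longrightarrow> y \<in> space M \<Longrightarrow> X x = X y \<longleftrightarrow> Y x = Y y"
  shows "\<H>(X) = \<H>(Y)"
  by (intro antisym entropy_determined) (use assms in auto)

lemma simple_function_measure_preserving:
  assumes "simple_function M X" and T: "T \<in> measurable M M"
  shows "simple_function M (\<lambda>x. X (T x))"
  using simple_function_comp[OF T assms(1)] by (simp add: comp_def)

lemma entropy_measure_preserving:
  assumes X: "simple_function M X" and T: "invariant_measure M T"
  shows "\<H>(\<lambda>x. X (T x)) = \<H>(X)"
proof -
  have m: "T \<in> measurable M M" and d: "distr M M T = M"
    using T by (auto simp: invariant_measure_def)
  have sp: "T x \<in> space M" if "x \<in> space M" for x
    using m that by (rule measurable_space)
  show ?thesis
  proof (rule entropy_eq_if_same_law[OF simple_function_measure_preserving[OF X m] X])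
    fix v
    have "prob (X -` {v} \<inter> space M) = measure (distr M M T) (X -` {v} \<inter> space M)"
      by (simp add: d)
    also have "\<dots> = prob (T -` (X -` {v} \<inter> space M) \<inter> space M)"
      by (rule measure_distr[OF m]) (use X in \<open>auto intro: simple_functionD\<close>)
    also have "T -` (X -` {v} \<inter> space M) \<inter> space M = (\<lambda>x. X (T x)) -` {v} \<inter> space M"
      using sp by auto
    finally show "prob ((\<lambda>x. X (T x)) -` {v} \<inter> space M) = prob (X -` {v} \<inter> space M)" by simp
  qed
qed

lemma simple_function_eq_sum_indicator:
  fixes g :: "'c \<Rightarrow> real"
  assumes X: "simple_function M X" and x: "x \<in> space M"
  shows "g (X x) = (\<Sum>v\<in>X ` space M. g v * indicator (X -` {v} \<inter> space M) x)"
proof -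
  have "(\<Sum>v\<in>X ` space M. g v * indicator (X -` {v} \<inter> space M) x)
      = (\<Sum>v\<in>X ` space M. if v = X x then g v else 0)"
    using x by (intro sum.cong) (auto simp: indicator_def)
  also have "\<dots> = g (X x)"
    using x X by (subst sum.delta) (auto simp: simple_function_def)
  finally show ?thesis by simp
qed

lemma integrable_simple:
  fixes g :: "'c \<Rightarrow> real"
  assumes X: "simple_function M X"
  shows "integrable M (\<lambda>x. g (X x))"
proof -
  have "integrable M (\<lambda>x. \<Sum>v\<in>X ` space M. g v * indicator (X -` {v} \<inter> space M) x)"
    by (intro Bochner_Integration.integrable_sum integrable_mult_right integrable_real_indicator
        simple_functionD(2)[OF X]) (simp add: emeasure_eq_measure)
  then show ?thesis
    by (rule iffD1[OF Bochner_Integration.integrable_cong, rotated 2])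
      (simp_all add: simple_function_eq_sum_indicator[OF X, of _ g])
qed

text \<open>Passing from sums over ranges to expectations brings variables with different ranges
  under one integral, where logarithms can be added pointwise.\<close>

lemma sum_simple_eq_expectation:
  fixes g :: "'c \<Rightarrow> real"
  assumes X: "simple_function M X"
  shows "(\<Sum>v\<in>X ` space M. prob (X -` {v} \<inter> space M) * g v) = expectation (\<lambda>x. g (X x))"
proof -
  have "expectation (\<lambda>x. g (X x)) =
      expectation (\<lambda>x. \<Sum>v\<in>X ` space M. g v * indicator (X -` {v} \<inter> space M) x)"
    by (intro Bochner_Integration.integral_cong refl simple_function_eq_sum_indicator[OF X])
  also have "\<dots> = (\<Sum>v\<in>X ` space M. expectation (\<lambda>x. g v * indicator (X -` {v} \<inter> space M) x))"
    by (intro Bochner_Integration.integral_sum integrable_mult_right integrable_real_indicator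
        simple_functionD(2)[OF X]) (simp add: emeasure_eq_measure)
  also have "\<dots> = (\<Sum>v\<in>X ` space M. prob (X -` {v} \<inter> space M) * g v)"
    by (intro sum.cong refl) (simp add: simple_functionD(2)[OF X] Int_absorb2 mult.commute)
  finally show ?thesis by simp
qed

text \<open>Only finitely many values occur, so the points whose value has probability 0 form a null
  set. Hence rules for logarithms and quotients may be used almost surely.\<close>

lemma AE_simple_prob_pos:
  assumes X: "simple_function M X"
  shows "AE x in M. 0 < prob (X -` {X x} \<inter> space M)"
proof -
  let ?N = "\<Union>v\<in>{v \<in> X ` space M. prob (X -` {v} \<inter> space M) = 0}. X -` {v} \<inter> space M"
  have "finite (X ` space M)" using X by (simp add: simple_function_def)
  then have "?N \<in> null_sets M"
    by (intro null_sets_UN') (auto intro!: countable_finite null_setsI simple_functionD[OF X] simp: emeasure_eq_measure)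
  then show ?thesis
    by (rule AE_I') (auto simp: zero_less_measure_iff)
qed

section \<open>Inequalities for conditional entropy\<close>

lemma conditional_entropy_eq_diff:
  assumes "simple_function M X" "simple_function M Y"
  shows "\<H>(Y \<bar> X) = \<H>(\<lambda>x. (X x, Y x)) - \<H>(X)"
  using entropy_chain_rule[OF assms] by simp

lemma entropy_eq_expectation:
  assumes "simple_function M X"
  shows "\<H>(X) = - expectation (\<lambda>x. log b (prob (X -` {X x} \<inter> space M)))"
  unfolding entropy_simple_distributed[OF simple_distributedI[OF assms measure_nonneg refl]]
  by (subst sum_simple_eq_expectation[OF assms, of "\<lambda>v. log b (prob (X -` {v} \<inter> space M))"]) simp

text \<open>This is the nonnegativity of the conditional mutual information of \<open>X\<close> and
  \<open>Y\<close> given \<open>Z\<close>, with its logarithm split into four entropies.\<close>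

lemma entropy_submodular:
  assumes X: "simple_function M X" and Y: "simple_function M Y" and Z: "simple_function M Z"
  shows "\<H>(\<lambda>x. (X x, Y x, Z x)) + \<H>(Z) \<le> \<H>(\<lambda>x. (X x, Z x)) + \<H>(\<lambda>x. (Y x, Z x))"
proof -
  note YZ = simple_function_Pair[OF Y Z] and XZ = simple_function_Pair[OF X Z]
  note XYZ = simple_function_Pair[OF X YZ]
  define pz where "pz v = prob (Z -` {v} \<inter> space M)" for v
  define pyz where "pyz v = prob ((\<lambda>x. (Y x, Z x)) -` {v} \<inter> space M)" for v
  define pxz where "pxz v = prob ((\<lambda>x. (X x, Z x)) -` {v} \<inter> space M)" for v
  define pxyz where "pxyz v = prob ((\<lambda>x. (X x, Y x, Z x)) -` {v} \<inter> space M)" for v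
  let ?g = "\<lambda>(x, y, z). log b (pxyz (x, y, z) / (pxz (x, z) * (pyz (y, z) / pz z)))"
  have "0 \<le> \<I>(X ; Y | Z)"
    by (rule conditional_mutual_information_nonneg[OF X Y Z])
  also have "\<dots> = (\<Sum>(x, y, z)\<in>(\<lambda>x. (X x, Y x, Z x)) ` space M.
      pxyz (x, y, z) * log b (pxyz (x, y, z) / (pxz (x, z) * (pyz (y, z) / pz z))))"
    unfolding pz_def pyz_def pxz_def pxyz_def
    by (rule conditional_mutual_information_eq; rule simple_distributedI)
       (use Z YZ XZ XYZ in auto)
  also have "\<dots> = (\<Sum>v\<in>(\<lambda>x. (X x, Y x, Z x)) ` space M. pxyz v * ?g v)"
    by (intro sum.cong) auto
  also have "\<dots> = expectation (\<lambda>x. ?g (X x, Y x, Z x))"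
    unfolding pxyz_def by (rule sum_simple_eq_expectation[OF XYZ])
  also have "\<dots> = expectation (\<lambda>x. log b (pxyz (X x, Y x, Z x)) - log b (pxz (X x, Z x))
       - log b (pyz (Y x, Z x)) + log b (pz (Z x)))"
  proof (rule integral_cong_AE)
    show "(\<lambda>x. ?g (X x, Y x, Z x)) \<in> borel_measurable M"
      using integrable_simple[OF XYZ, of ?g] by simp
    show "(\<lambda>x. log b (pxyz (X x, Y x, Z x)) - log b (pxz (X x, Z x))
       - log b (pyz (Y x, Z x)) + log b (pz (Z x))) \<in> borel_measurable M"
      using integrable_simple[OF XYZ, of "\<lambda>(x, y, z). log b (pxyz (x, y, z)) - log b (pxz (x, z))
       - log b (pyz (y, z)) + log b (pz z)"] by simp
    show "AE x in M. ?g (X x, Y x, Z x) = log b (pxyz (X x, Y x, Z x)) - log b (pxz (X x, Z x))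
       - log b (pyz (Y x, Z x)) + log b (pz (Z x))"
      using AE_simple_prob_pos[OF Z] AE_simple_prob_pos[OF XZ] AE_simple_prob_pos[OF YZ]
        AE_simple_prob_pos[OF XYZ]
    proof eventually_elim
      case (elim x)
      then show ?case
        using b_gt_1 by (simp add: pz_def pyz_def pxz_def pxyz_def log_mult log_divide)
    qed
  qed
  also have "\<dots> = \<H>(\<lambda>x. (X x, Z x)) + \<H>(\<lambda>x. (Y x, Z x)) - \<H>(\<lambda>x. (X x, Y x, Z x)) - \<H>(Z)"
    using integrable_simple[OF XYZ, of "\<lambda>v. log b (pxyz v)"]
      integrable_simple[OF XZ, of "\<lambda>v. log b (pxz v)"]
      integrable_simple[OF YZ, of "\<lambda>v. log b (pyz v)"]
      integrable_simple[OF Z, of "\<lambda>v. log b (pz v)"]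
    unfolding entropy_eq_expectation[OF XYZ] entropy_eq_expectation[OF XZ]
      entropy_eq_expectation[OF YZ] entropy_eq_expectation[OF Z]
      pz_def[symmetric] pyz_def[symmetric] pxz_def[symmetric] pxyz_def[symmetric]
    by simp
  finally show ?thesis by simp
qed

lemma conditional_entropy_mono:
  assumes X: "simple_function M X" and X': "simple_function M X'" and Y: "simple_function M Y"
    and "\<And>x y. x \<in> space M \<Longrightarrow> y \<in> space M \<Longrightarrow> X' x = X' y \<Longrightarrow> X x = X y"
  shows "\<H>(X \<bar> Y) \<le> \<H>(X' \<bar> Y)"
  unfolding conditional_entropy_eq_diff[OF Y X] conditional_entropy_eq_diff[OF Y X']
  by (intro diff_right_mono entropy_determined simple_function_Pair X X' Y)
    (metis assms(4) prod.inject)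

text \<open>Since \<open>Y\<close> determines \<open>Z\<close>, the component \<open>Z\<close> may
  be dropped next to \<open>Y\<close> in \<open>entropy_submodular\<close>; a rearrangement of what
  remains is the claim.\<close>

lemma conditional_entropy_antimono:
  assumes X: "simple_function M X" and Y: "simple_function M Y" and Z: "simple_function M Z"
    and det: "\<And>x y. x \<in> space M \<Longrightarrow> y \<in> space M \<Longrightarrow> Y x = Y y \<Longrightarrow> Z x = Z y"
  shows "\<H>(X \<bar> Y) \<le> \<H>(X \<bar> Z)"
proof -
  have "\<H>(\<lambda>x. (X x, Y x, Z x)) + \<H>(Z) \<le> \<H>(\<lambda>x. (X x, Z x)) + \<H>(\<lambda>x. (Y x, Z x))"
    by (rule entropy_submodular[OF X Y Z])
  moreover have "\<H>(\<lambda>x. (X x, Y x, Z x)) = \<H>(\<lambda>x. (Y x, X x))"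
    by (intro entropy_determined_eq simple_function_Pair X Y Z) (simp only: prod.inject; blast dest: det)
  moreover have "\<H>(\<lambda>x. (X x, Z x)) = \<H>(\<lambda>x. (Z x, X x))"
    by (intro entropy_determined_eq simple_function_Pair X Y Z) (simp only: prod.inject; blast dest: det)
  moreover have "\<H>(\<lambda>x. (Y x, Z x)) = \<H>(Y)"
    by (intro entropy_determined_eq simple_function_Pair X Y Z) (simp only: prod.inject; blast dest: det)
  ultimately show ?thesis
    unfolding conditional_entropy_eq_diff[OF Y X] conditional_entropy_eq_diff[OF Z X] by simp
qed

lemma conditional_entropy_Pair_le:
  assumes X: "simple_function M X" and Y: "simple_function M Y" and Z: "simple_function M Z"
  shows "\<H>(\<lambda>x. (X x, Y x) \<bar> Z) \<le> \<H>(X \<bar> Z) + \<H>(Y \<bar> Z)"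
proof -
  have "\<H>(\<lambda>x. (X x, Y x, Z x)) = \<H>(\<lambda>x. (Z x, X x, Y x))"
    by (intro entropy_determined_eq simple_function_Pair X Y Z) auto
  moreover have "\<H>(\<lambda>x. (X x, Z x)) = \<H>(\<lambda>x. (Z x, X x))"
    by (intro entropy_determined_eq simple_function_Pair X Y Z) auto
  moreover have "\<H>(\<lambda>x. (Y x, Z x)) = \<H>(\<lambda>x. (Z x, Y x))"
    by (intro entropy_determined_eq simple_function_Pair X Y Z) auto
  ultimately show ?thesis
    using entropy_submodular[OF X Y Z]
    by (simp add: conditional_entropy_eq_diff simple_function_Pair X Y Z)
qed

lemma conditional_entropy_measure_preserving:
  assumes X: "simple_function M X" and Y: "simple_function M Y" and T: "invariant_measure M T"
  shows "\<H>(\<lambda>x. X (T x) \<bar> \<lambda>x. Y (T x)) = \<H>(X \<bar> Y)"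
proof -
  have m: "T \<in> measurable M M" using T by (simp add: invariant_measure_def)
  note m1 = simple_function_measure_preserving[OF X m]
  note m2 = simple_function_measure_preserving[OF Y m]
  show ?thesis
    using entropy_measure_preserving[OF simple_function_Pair[OF Y X] T]
      entropy_measure_preserving[OF Y T]
    by (simp add: conditional_entropy_eq_diff X Y m1 m2)
qed

text \<open>The inequality \<open>ln r <= r - 1\<close> takes the place of Jensen's inequality on
  each fibre of \<open>Y\<close>.\<close>

lemma conditional_entropy_le_log_card:
  assumes X: "simple_function M X" and Y: "simple_function M Y"
    and N: "\<And>x. x \<in> space M \<Longrightarrow> card (X ` {y \<in> space M. Y y = Y x}) \<le> N"
  shows "\<H>(X \<bar> Y) \<le> log b (real N)"
proof -
  note YX = simple_function_Pair[OF Y X]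
  have finX: "finite (X ` space M)" and finY: "finite (Y ` space M)"
    using X Y by (auto simp: simple_function_def)
  have "N > 0"
  proof -
    obtain x where x: "x \<in> space M" using not_empty by blast
    have "finite (X ` {y \<in> space M. Y y = Y x})"
      by (rule finite_subset[OF _ finX]) auto
    then have "card (X ` {y \<in> space M. Y y = Y x}) > 0"
      using x by (auto simp: card_gt_0_iff)
    with N[OF x] show ?thesis by simp
  qed
  have lnb: "ln b > 0" using b_gt_1 by simp
  define py where "py v = prob (Y -` {v} \<inter> space M)" for v
  define pyx where "pyx v = prob ((\<lambda>x. (Y x, X x)) -` {v} \<inter> space M)" for v
  have py_nn: "0 \<le> py v" for v by (simp add: py_def)
  have py_sum: "(\<Sum>v\<in>Y ` space M. py v) = 1"
    using sum_simple_eq_expectation[OF Y, of "\<lambda>_. 1"] by (simp add: py_def prob_space)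
  \<comment> \<open>\<open>?r\<close> compares the uniform law on \<open>N\<close> values with the
    conditional law of \<open>X\<close> given \<open>Y\<close>. The excess of the entropy over
    \<open>log b N\<close> is at most the mean of \<open>?r - 1\<close>, divided by
    \<open>ln b\<close>.\<close>
  let ?r = "\<lambda>x. py (Y x) / (real N * pyx (Y x, X x))"
  have AE: "AE x in M. - log b (pyx (Y x, X x)) + log b (py (Y x)) - log b (real N)
      \<le> (?r x - 1) / ln b"
    using AE_simple_prob_pos[OF Y] AE_simple_prob_pos[OF YX]
  proof eventually_elim
    case (elim x)
    then have "ln (?r x) \<le> ?r x - 1"
      using \<open>N > 0\<close> by (intro ln_le_minus_one) (simp add: py_def pyx_def)
    moreover have "ln (?r x) = ln (py (Y x)) - ln (real N) - ln (pyx (Y x, X x))"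
      using elim \<open>N > 0\<close> by (simp add: py_def pyx_def ln_div ln_mult)
    moreover have "- log b (pyx (Y x, X x)) + log b (py (Y x)) - log b (real N)
        = (ln (py (Y x)) - ln (real N) - ln (pyx (Y x, X x))) / ln b"
      by (simp add: log_def diff_divide_distrib)
    ultimately show ?case
      using lnb by (simp only: divide_right_mono less_imp_le)
  qed
  have "\<H>(X \<bar> Y) - log b (real N) =
      expectation (\<lambda>x. - log b (pyx (Y x, X x)) + log b (py (Y x)) - log b (real N))"
    using integrable_simple[OF YX, of "\<lambda>v. log b (pyx v)"] integrable_simple[OF Y, of "\<lambda>v. log b (py v)"]
    unfolding conditional_entropy_eq_diff[OF Y X] entropy_eq_expectation[OF YX]
      entropy_eq_expectation[OF Y] py_def[symmetric] pyx_def[symmetric]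
    by (simp add: prob_space)
  also have "\<dots> \<le> expectation (\<lambda>x. (?r x - 1) / ln b)"
    using integrable_simple[OF YX, of "\<lambda>v. - log b (pyx v) + log b (py (fst v)) - log b (real N)"]
      integrable_simple[OF YX, of "\<lambda>v. (py (fst v) / (real N * pyx v) - 1) / ln b"]
    by (intro integral_mono_AE AE) simp_all
  also have "\<dots> = (expectation ?r - 1) / ln b"
    using integrable_simple[OF YX, of "\<lambda>v. py (fst v) / (real N * pyx v)"]
    by (simp add: prob_space)
  also have "expectation ?r \<le> 1"
  proof -
    have "expectation ?r = (\<Sum>v\<in>(\<lambda>x. (Y x, X x)) ` space M. pyx v * (py (fst v) / (real N * pyx v)))"
      using sum_simple_eq_expectation[OF YX, of "\<lambda>v. py (fst v) / (real N * pyx v)"]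
      by (simp add: pyx_def)
    \<comment> \<open>Pairs of probability 0 contribute 0 on the left, whatever the quotient is,
      hence an inequality instead of an equation.\<close>
    also have "\<dots> \<le> (\<Sum>v\<in>(\<lambda>x. (Y x, X x)) ` space M. py (fst v) / real N)"
      by (intro sum_mono) (use \<open>N > 0\<close> py_nn in \<open>auto simp: field_simps\<close>)
    \<comment> \<open>Grouping the pairs by their first component leaves at most \<open>N\<close>
      equal terms for each value of \<open>Y\<close>.\<close>
    also have "(\<lambda>x. (Y x, X x)) ` space M = (SIGMA v:Y ` space M. X ` {y \<in> space M. Y y = v})"
      by (auto simp: image_iff; metis)
    also have "(\<Sum>v\<in>\<dots>. py (fst v) / real N)
        = (\<Sum>v\<in>Y ` space M. \<Sum>w\<in>X ` {y \<in> space M. Y y = v}. py v / real N)"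
      by (subst sum.Sigma) (auto intro: finite_subset[OF _ finX] finY simp: case_prod_beta)
    also have "\<dots> = (\<Sum>v\<in>Y ` space M. real (card (X ` {y \<in> space M. Y y = v})) * (py v / real N))"
      by simp
    also have "\<dots> \<le> (\<Sum>v\<in>Y ` space M. py v)"
    proof (intro sum_mono)
      fix v assume "v \<in> Y ` space M"
      then have "real (card (X ` {y \<in> space M. Y y = v})) \<le> real N"
        using N by auto
      then have "real (card (X ` {y \<in> space M. Y y = v})) * (py v / real N) \<le> real N * (py v / real N)"
        using py_nn by (intro mult_right_mono) auto
      then show "real (card (X ` {y \<in> space M. Y y = v})) * (py v / real N) \<le> py v"
        using \<open>N > 0\<close> by simp
    qed
    finally show ?thesis by (simp add: py_sum)
  qed
  then have "(expectation ?r - 1) / ln b \<le> 0"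
    using lnb by (simp add: divide_nonpos_pos)
  finally show ?thesis by simp
qed

end

section \<open>Entropy of orbit words\<close>

text \<open>Names of points along orbits, coded as lists: prefixes are shorter names, and a join of
  pulled-back partitions becomes the partition into fibres of a single function.\<close>

definition orbit_word :: "('x \<Rightarrow> 'x) \<Rightarrow> ('x \<Rightarrow> 'c) \<Rightarrow> nat \<Rightarrow> 'x \<Rightarrow> 'c list" where
  "orbit_word T X n x = map (\<lambda>i. X ((T ^^ i) x)) [0..<n]"

lemma orbit_word_0 [simp]: "orbit_word T X 0 x = []"
  by (simp add: orbit_word_def)

lemma length_orbit_word [simp]: "length (orbit_word T X n x) = n"
  by (simp add: orbit_word_def)

lemma take_orbit_word: "j \<le> k \<Longrightarrow> take j (orbit_word T X k x) = orbit_word T X j x"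
  by (simp add: orbit_word_def take_map)

lemma orbit_word_eq_iff:
  "orbit_word T X n x = orbit_word T X n y \<longleftrightarrow> (\<forall>i<n. X ((T ^^ i) x) = X ((T ^^ i) y))"
  by (auto simp: orbit_word_def)

lemma orbit_word_Suc: "orbit_word T X (Suc n) x = orbit_word T X n x @ [X ((T ^^ n) x)]"
  by (simp add: orbit_word_def)

lemma orbit_word_Suc_Cons: "orbit_word T X (Suc n) x = X x # orbit_word T X n (T x)"
  by (simp add: orbit_word_def upt_conv_Cons funpow_swap1 map_Suc_upt[symmetric] del: upt_Suc)

lemma orbit_word_add: "orbit_word T X (n + k) x = orbit_word T X n x @ orbit_word T X k ((T ^^ n) x)"
proof (induction k)
  case (Suc k)
  have "(T ^^ (n + k)) x = (T ^^ k) ((T ^^ n) x)"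
    by (metis add.commute comp_apply funpow_add)
  with Suc show ?case
    by (simp add: orbit_word_Suc)
qed simp

lemma invariant_measure_measurable: "invariant_measure M T \<Longrightarrow> T \<in> measurable M M"
  by (simp add: invariant_measure_def)

lemma invariant_measure_funpow:
  assumes "invariant_measure M T"
  shows "invariant_measure M (T ^^ n)"
proof (induction n)
  case 0
  then show ?case by (auto simp: invariant_measure_def distr_id id_def)
next
  case (Suc n)
  then show ?case
    using assms unfolding invariant_measure_def
    by (auto simp: distr_distr[symmetric] intro!: measurable_comp)
qed

lemma AE_invariant_measure:
  assumes "invariant_measure M T" and "AE x in M. P x"
  shows "AE x in M. P (T x)"
  using assms AE_distrD[of T M M P] unfolding invariant_measure_def by metis

text \<open>By monotonicity every term is at least \<open>h\<close>, and every term from index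
  \<open>k\<close> on is at most \<open>d k\<close>; the finitely many earlier terms vanish after
  division by \<open>n\<close>.\<close>

lemma decseq_Cesaro:
  fixes d :: "nat \<Rightarrow> real"
  assumes "decseq d" and "d \<longlonglongrightarrow> h" and nn: "\<And>n. 0 \<le> d n"
  shows "(\<lambda>n. (\<Sum>i<n. d i) / real n) \<longlonglongrightarrow> h"
proof (rule LIMSEQ_I)
  fix e :: real assume "e > 0"
  have ge: "h \<le> d n" for n by (rule decseq_ge[OF assms(1,2)])
  obtain k where k: "d k < h + e / 2"
    using order_tendstoD(2)[OF assms(2), of "h + e / 2"] \<open>e > 0\<close>
    by (auto simp: eventually_sequentially)
  have "(\<lambda>n. (\<Sum>i<k. d i) / real n) \<longlonglongrightarrow> 0"
    by (rule lim_const_over_n)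
  then have "\<forall>\<^sub>F n in sequentially. (\<Sum>i<k. d i) / real n < e / 2"
    using \<open>e > 0\<close> by (intro order_tendstoD(2)) auto
  then have "\<forall>\<^sub>F n in sequentially. norm ((\<Sum>i<n. d i) / real n - h) < e"
    using eventually_gt_at_top[of k]
  proof eventually_elim
    case (elim n)
    have "real n * h \<le> (\<Sum>i<n. d i)"
      using sum_bounded_below[of "{..<n}" h d] ge by simp
    then have lower: "h \<le> (\<Sum>i<n. d i) / real n"
      using elim by (simp add: field_simps)
    have "(\<Sum>i<n. d i) = (\<Sum>i<k. d i) + (\<Sum>i=k..<n. d i)"
      using elim by (simp add: sum.atLeastLessThan_concat[of 0 k n d] flip: atLeast0LessThan)
    also have "(\<Sum>i=k..<n. d i) \<le> real (n - k) * d k"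
      using sum_bounded_above[of "{k..<n}" d "d k"] assms(1) by (simp add: decseqD)
    also have "real (n - k) * d k \<le> real n * d k"
      using nn by (intro mult_right_mono) auto
    finally have "(\<Sum>i<n. d i) / real n \<le> (\<Sum>i<k. d i) / real n + d k"
      using elim by (simp add: field_simps)
    with lower k elim show ?case
      unfolding real_norm_def abs_less_iff by linarith
  qed
  then show "\<exists>no. \<forall>n\<ge>no. norm ((\<Sum>i<n. d i) / real n - h) < e"
    by (simp add: eventually_sequentially)
qed

section \<open>The entropy rate along orbits\<close>

context information_space
begin

lemma simple_function_orbit_word:
  assumes X: "simple_function M X" and T: "invariant_measure M T"
  shows "simple_function M (orbit_word T X n)"
proof (induction n)
  case 0
  have "orbit_word T X 0 = (\<lambda>_. [])" by (rule ext) simp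
  then show ?case by simp
next
  case (Suc n)
  have "simple_function M (\<lambda>x. X ((T ^^ n) x))"
    by (rule simple_function_measure_preserving[OF X])
      (rule invariant_measure_measurable[OF invariant_measure_funpow[OF T]])
  from simple_function_compose2[OF Suc this, of "\<lambda>l a. l @ [a]"]
  show ?case by (simp add: orbit_word_Suc[abs_def])
qed

lemma simple_function_indicator_pred:
  "A \<in> sets M \<Longrightarrow> simple_function M (\<lambda>x. x \<in> A)"
  by (auto simp: simple_function_def intro: finite_subset[of _ UNIV])

text \<open>The first letter is split off, not the last, so the increment conditions the present on
  the word read from \<open>T x\<close>. This form later makes events of zero entropy functions of
  \<open>T x\<close>.\<close>

lemma entropy_orbit_word_Suc:
  assumes X: "simple_function M X" and T: "invariant_measure M T"
  shows "\<H>(orbit_word T X (Suc n)) - \<H>(orbit_word T X n)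
    = \<H>(X \<bar> \<lambda>x. orbit_word T X n (T x))"
proof -
  note w = simple_function_orbit_word[OF X T]
  note wT = simple_function_measure_preserving[OF w invariant_measure_measurable[OF T], of n]
  have "\<H>(orbit_word T X (Suc n)) = \<H>(\<lambda>x. (orbit_word T X n (T x), X x))"
    by (intro entropy_determined_eq w simple_function_Pair wT X) (auto simp: orbit_word_Suc_Cons)
  then show ?thesis
    using entropy_measure_preserving[OF w T, of n]
    by (simp add: conditional_entropy_eq_diff[OF wT X])
qed

lemma entropy_const: "\<H>(\<lambda>_. c) = 0"
  by (subst entropy_eq_sum[of _ "{c}"]) (auto simp: prob_space)

text \<open>Longer conditioning words lower the increments, so these converge. They telescope to the
  word entropies, and averaging yields the same limit, the entropy rate.\<close>

lemma entropy_orbit_word_increments: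
  assumes X: "simple_function M X" and T: "invariant_measure M T"
  defines "d \<equiv> \<lambda>n. \<H>(X \<bar> \<lambda>x. orbit_word T X n (T x))"
  obtains h where "decseq d" "0 \<le> h" "d \<longlonglongrightarrow> h"
    "(\<lambda>n. \<H>(orbit_word T X n) / real n) \<longlonglongrightarrow> h"
proof -
  note w = simple_function_orbit_word[OF X T]
  note wT = simple_function_measure_preserving[OF w invariant_measure_measurable[OF T]]
  have nn: "0 \<le> d n" for n
    unfolding d_def by (rule conditional_entropy_nonneg[OF X wT])
  have dec: "decseq d"
    unfolding d_def
    by (intro decseq_SucI conditional_entropy_antimono X wT) (simp add: orbit_word_Suc)
  obtain h where h: "d \<longlonglongrightarrow> h"
    using decseq_convergent[OF dec, of 0] nn by blast
  have "\<H>(orbit_word T X n) = (\<Sum>i<n. d i)" for n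
  proof (induction n)
    case 0
    have "orbit_word T X 0 = (\<lambda>_. [])" by (rule ext) simp
    then show ?case by (simp only: entropy_const) simp
  next
    case (Suc n)
    then show ?case using entropy_orbit_word_Suc[OF X T, of n] by (simp add: d_def)
  qed
  then have "(\<lambda>n. \<H>(orbit_word T X n) / real n) \<longlonglongrightarrow> h"
    using decseq_Cesaro[OF dec h nn] by simp
  with dec h show ?thesis
    using LIMSEQ_le_const[OF h, of 0] nn by (intro that) auto
qed

text \<open>Each of the \<open>n\<close> further letters adds one increment, and a decreasing
  sequence stays above its limit.\<close>

lemma entropy_orbit_word_add_ge:
  assumes X: "simple_function M X" and T: "invariant_measure M T"
    and h: "(\<lambda>n. \<H>(orbit_word T X n) / real n) \<longlonglongrightarrow> h"
  shows "\<H>(orbit_word T X k) + real n * h \<le> \<H>(orbit_word T X (k + n))"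
proof -
  obtain h' where d: "decseq (\<lambda>n. \<H>(X \<bar> \<lambda>x. orbit_word T X n (T x)))"
    "(\<lambda>n. \<H>(X \<bar> \<lambda>x. orbit_word T X n (T x))) \<longlonglongrightarrow> h'"
    and "(\<lambda>n. \<H>(orbit_word T X n) / real n) \<longlonglongrightarrow> h'"
    by (rule entropy_orbit_word_increments[OF X T])
  with h have "h' = h" using LIMSEQ_unique by blast
  show ?thesis
  proof (induction n)
    case (Suc n)
    then show ?case
      using entropy_orbit_word_Suc[OF X T, of "k + n"] decseq_ge[OF d, of "k + n"] \<open>h' = h\<close>
      by (simp add: algebra_simps)
  qed simp
qed

lemma entropy_orbit_word_add_le:
  assumes X: "simple_function M X" and T: "invariant_measure M T"
  shows "\<H>(orbit_word T X (n + k)) \<le> \<H>(orbit_word T X n) + \<H>(orbit_word T X k)"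
proof -
  note w = simple_function_orbit_word[OF X T]
  note Tn = invariant_measure_funpow[OF T, of n]
  note wT = simple_function_measure_preserving[OF w invariant_measure_measurable[OF Tn], of k]
  have "\<H>(orbit_word T X (n + k)) \<le> \<H>(\<lambda>x. (orbit_word T X n x, orbit_word T X k ((T ^^ n) x)))"
    by (intro entropy_determined w simple_function_Pair wT) (auto simp: orbit_word_add)
  also have "\<dots> = \<H>(orbit_word T X n) + \<H>(\<lambda>x. orbit_word T X k ((T ^^ n) x) \<bar> orbit_word T X n)"
    by (rule entropy_chain_rule[OF w wT])
  also have "\<dots> \<le> \<H>(orbit_word T X n) + \<H>(orbit_word T X k)"
    using conditional_entropy_less_eq_entropy[OF wT w, of n] entropy_measure_preserving[OF w Tn, of k]
    by simp
  finally show ?thesis .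
qed

end

section \<open>Zero entropy and tail events\<close>

text \<open>The tail sigma-algebra of \<open>T\<close>, the null sets being absorbed at each
  \<open>n\<close> separately.\<close>

definition tail_event :: "'x measure \<Rightarrow> ('x \<Rightarrow> 'x) \<Rightarrow> 'x set \<Rightarrow> bool" where
  "tail_event M T A \<longleftrightarrow>
     A \<in> sets M \<and> (\<forall>n. \<exists>B\<in>sets M. AE x in M. x \<in> A \<longleftrightarrow> (T ^^ n) x \<in> B)"

text \<open>Generation is expressed through approximation in measure, which controls conditional
  entropies directly.\<close>

definition approximable :: "'x measure \<Rightarrow> ('x \<Rightarrow> 'x) \<Rightarrow> ('x \<Rightarrow> 'c) \<Rightarrow> 'x set \<Rightarrow> bool" where
  "approximable M T X A \<longleftrightarrow>
     (\<forall>e>0. \<exists>k G. measure M {x \<in> space M. (x \<in> A) \<noteq> (orbit_word T X k x \<in> G)} < e)"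

definition generates :: "'x measure \<Rightarrow> ('x \<Rightarrow> 'x) \<Rightarrow> ('x \<Rightarrow> 'c) \<Rightarrow> bool" where
  "generates M T X \<longleftrightarrow> (\<forall>A\<in>sets M. approximable M T X A)"

context information_space
begin

lemma simple_function_sets:
  assumes "simple_function M Y"
  shows "{x \<in> space M. Y x \<in> G} \<in> sets M"
proof -
  have "{x \<in> space M. Y x \<in> G} = (\<lambda>x. Y x \<in> G) -` {True} \<inter> space M" by auto
  then show ?thesis
    using simple_functionD(2)[OF simple_function_compose1[OF assms, of "\<lambda>v. v \<in> G"], of "{True}"] by simp
qed

text \<open>The event is guessed from \<open>Y\<close> by maximum likelihood. Where the guess fails,
  the conditional probability of what happens is at most 1/2, so such a point contributes at least
  \<open>1 / (2 ln b)\<close> to the conditional entropy.\<close>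

lemma event_approximation_from_conditional_entropy:
  assumes A: "A \<in> sets M" and Y: "simple_function M Y"
  shows "\<exists>G. prob {x \<in> space M. (x \<in> A) \<noteq> (Y x \<in> G)} \<le> 2 * ln b * \<H>(\<lambda>x. x \<in> A \<bar> Y)"
proof -
  note X = simple_function_indicator_pred[OF A]
  note YX = simple_function_Pair[OF Y X]
  have lnb: "ln b > 0" using b_gt_1 by simp
  define py where "py v = prob (Y -` {v} \<inter> space M)" for v
  define pyx where "pyx v = prob ((\<lambda>x. (Y x, x \<in> A)) -` {v} \<inter> space M)" for v
  have split: "py v = pyx (v, a) + pyx (v, \<not> a)" for v a
  proof -
    have "Y -` {v} \<inter> space M = ((\<lambda>x. (Y x, x \<in> A)) -` {(v, a)} \<inter> space M)
        \<union> ((\<lambda>x. (Y x, x \<in> A)) -` {(v, \<not> a)} \<inter> space M)"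
      by auto
    then show ?thesis
      unfolding py_def pyx_def
      using finite_measure_Union[OF simple_functionD(2)[OF YX, of "{(v, a)}"]
          simple_functionD(2)[OF YX, of "{(v, \<not> a)}"]]
      by auto
  qed
  define G where "G = {v. pyx (v, False) \<le> pyx (v, True)}"
  let ?D = "{x \<in> space M. (x \<in> A) \<noteq> (Y x \<in> G)}"
  have D: "?D \<in> sets M"
    using simple_function_sets[OF YX, of "{(v, a). a \<noteq> (v \<in> G)}"] by simp
  have AE: "AE x in M. indicator ?D x / (2 * ln b)
      \<le> log b (py (Y x)) - log b (pyx (Y x, x \<in> A))"
    using AE_simple_prob_pos[OF Y] AE_simple_prob_pos[OF YX] AE_space
  proof eventually_elim
    case (elim x)
    define t where "t = pyx (Y x, x \<in> A) / py (Y x)"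
    have pos: "0 < py (Y x)" "0 < pyx (Y x, x \<in> A)"
      using elim by (auto simp: py_def pyx_def)
    have "0 < t" using pos by (simp add: t_def)
    have "pyx (Y x, x \<in> A) \<le> py (Y x)"
      using split[of "Y x" "x \<in> A"] by (simp add: pyx_def)
    then have t1: "t \<le> 1" using pos by (simp add: t_def)
    have t2: "t \<le> 1 / 2" if "x \<in> ?D"
    proof -
      have "pyx (Y x, x \<in> A) \<le> pyx (Y x, x \<notin> A)"
        using that by (cases "x \<in> A") (auto simp: G_def)
      then show ?thesis
        using split[of "Y x" "x \<in> A"] pos by (simp add: t_def field_simps)
    qed
    have "indicator ?D x / 2 \<le> 1 - t"
      using t1 t2 by (auto simp: indicator_def)
    also have "\<dots> \<le> - ln t"
      using ln_le_minus_one[OF \<open>0 < t\<close>] by simp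
    also have "- ln t = ln (py (Y x)) - ln (pyx (Y x, x \<in> A))"
      using pos by (simp add: t_def ln_div)
    finally have "indicator ?D x / 2 / ln b \<le> (ln (py (Y x)) - ln (pyx (Y x, x \<in> A))) / ln b"
      using lnb by (intro divide_right_mono) auto
    then show ?case by (simp add: log_def diff_divide_distrib)
  qed
  have "prob ?D / (2 * ln b) = expectation (\<lambda>x. indicator ?D x / (2 * ln b))"
    using D by (simp add: Int_absorb2)
  also have "\<dots> \<le> expectation (\<lambda>x. log b (py (Y x)) - log b (pyx (Y x, x \<in> A)))"
    using D integrable_simple[OF YX, of "\<lambda>v. log b (py (fst v)) - log b (pyx v)"] AE
    by (intro integral_mono_AE) (auto simp: emeasure_eq_measure)
  also have "\<dots> = \<H>(\<lambda>x. x \<in> A \<bar> Y)"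
    using integrable_simple[OF YX, of "\<lambda>v. log b (pyx v)"] integrable_simple[OF Y, of "\<lambda>v. log b (py v)"]
    unfolding conditional_entropy_eq_diff[OF Y X] entropy_eq_expectation[OF YX]
      entropy_eq_expectation[OF Y] py_def[symmetric] pyx_def[symmetric]
    by simp
  finally show ?thesis
    using lnb by (intro exI[of _ G]) (simp add: field_simps)
qed

text \<open>Approximations with summable errors are chosen. By the Borel-Cantelli lemma almost every
  point is misclassified only finitely often, so the lower limit of the approximating sets is as
  required.\<close>

lemma event_limit:
  assumes A: "A \<in> sets M" and f: "f \<in> measurable M N"
    and approx: "\<And>e. e > 0 \<Longrightarrow> \<exists>B\<in>sets N. prob {x \<in> space M. (x \<in> A) \<noteq> (f x \<in> B)} < e"
  shows "\<exists>B\<in>sets N. AE x in M. x \<in> A \<longleftrightarrow> f x \<in> B"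
proof -
  have "\<forall>n. \<exists>B\<in>sets N. prob {x \<in> space M. (x \<in> A) \<noteq> (f x \<in> B)} < (1 / 2) ^ n"
    by (intro allI approx) simp
  then obtain B where B [measurable]: "\<And>n. B n \<in> sets N"
    and less: "\<And>n. prob {x \<in> space M. (x \<in> A) \<noteq> (f x \<in> B n)} < (1 / 2) ^ n"
    by metis
  note [measurable] = A f
  define D where "D n = {x \<in> space M. (x \<in> A) \<noteq> (f x \<in> B n)}" for n
  have D: "D n \<in> sets M" for n
    unfolding D_def by measurable
  have "summable (\<lambda>n. prob (D n))"
    by (rule summable_comparison_test'[of "\<lambda>n. (1 / 2) ^ n" 0])
      (use less in \<open>auto simp: D_def intro: less_imp_le\<close>)
  then have AE: "AE x in M. eventually (\<lambda>n. x \<in> space M - D n) sequentially"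
    by (intro borel_cantelli_AE1 D) (simp_all add: emeasure_eq_measure)
  let ?B = "{y \<in> space N. \<exists>m. \<forall>n\<ge>m. y \<in> B n}"
  show ?thesis
  proof (rule bexI)
    show "?B \<in> sets N" by measurable
    show "AE x in M. x \<in> A \<longleftrightarrow> f x \<in> ?B"
      using AE AE_space
    proof eventually_elim
      case (elim x)
      then obtain m where m: "\<And>n. n \<ge> m \<Longrightarrow> x \<in> A \<longleftrightarrow> f x \<in> B n"
        by (auto simp: eventually_sequentially D_def)
      have "x \<in> A" if "\<forall>n\<ge>m'. f x \<in> B n" for m'
        using m[of "max m m'"] that by simp
      then show ?case
        using m measurable_space[OF f] elim by blast
    qed
  qed
qed

text \<open>At rate 0 the increments tend to 0, so long words read from \<open>T x\<close> almost
  decide whether \<open>x\<close> lies in \<open>A\<close>. The approximating sets are preimages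
  under \<open>T\<close>, and \<open>event_limit\<close> makes the approximation exact.\<close>

lemma zero_entropy_event_factor:
  assumes A: "A \<in> sets M" and T: "invariant_measure M T"
    and h: "(\<lambda>n. \<H>(orbit_word T (\<lambda>x. x \<in> A) n) / real n) \<longlonglongrightarrow> 0"
  shows "\<exists>B\<in>sets M. AE x in M. x \<in> A \<longleftrightarrow> T x \<in> B"
proof (rule event_limit[OF A invariant_measure_measurable[OF T]])
  fix e :: real assume "e > 0"
  note X = simple_function_indicator_pred[OF A]
  note w = simple_function_orbit_word[OF X T]
  note wT = simple_function_measure_preserving[OF w invariant_measure_measurable[OF T]]
  have lnb: "ln b > 0" using b_gt_1 by simp
  let ?d = "\<lambda>n. \<H>(\<lambda>x. x \<in> A \<bar> \<lambda>x. orbit_word T (\<lambda>x. x \<in> A) n (T x))"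
  obtain h' where "?d \<longlonglongrightarrow> h'"
    "(\<lambda>n. \<H>(orbit_word T (\<lambda>x. x \<in> A) n) / real n) \<longlonglongrightarrow> h'"
    by (rule entropy_orbit_word_increments[OF X T])
  with h have "?d \<longlonglongrightarrow> 0" using LIMSEQ_unique by blast
  then have "(\<lambda>n. 2 * ln b * ?d n) \<longlonglongrightarrow> 0"
    by (rule tendsto_mult_right_zero)
  then obtain n where n: "2 * ln b * ?d n < e"
    using \<open>e > 0\<close> order_tendstoD(2)[of _ 0 sequentially e] by (auto simp: eventually_sequentially)
  obtain G where "prob {x \<in> space M. (x \<in> A) \<noteq> (orbit_word T (\<lambda>x. x \<in> A) n (T x) \<in> G)} \<le> 2 * ln b * ?d n"
    using event_approximation_from_conditional_entropy[OF A wT] by blast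
  moreover have "{x \<in> space M. (x \<in> A) \<noteq> (orbit_word T (\<lambda>x. x \<in> A) n (T x) \<in> G)}
    = {x \<in> space M. (x \<in> A) \<noteq> (T x \<in> {x \<in> space M. orbit_word T (\<lambda>x. x \<in> A) n x \<in> G})}"
    using measurable_space[OF invariant_measure_measurable[OF T]] by auto
  ultimately show "\<exists>B\<in>sets M. prob {x \<in> space M. (x \<in> A) \<noteq> (T x \<in> B)} < e"
    using n simple_function_sets[OF w, of n G]
    by (intro bexI[of _ "{x \<in> space M. orbit_word T (\<lambda>x. x \<in> A) n x \<in> G}"]) simp_all
qed

text \<open>Commutation turns the almost sure identity of letters into one of words, and invariance
  under \<open>S\<close> removes the shift. With \<open>S\<close> equal to \<open>T\<close>, zero
  entropy passes from an event to the event it is pulled back from.\<close>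

lemma entropy_orbit_word_factor:
  assumes X: "simple_function M X" and Y: "simple_function M Y"
    and T: "invariant_measure M T" and S: "invariant_measure M S"
    and comm: "\<And>x i. x \<in> space M \<Longrightarrow> S ((T ^^ i) x) = (T ^^ i) (S x)"
    and eq: "AE x in M. X x = Y (S x)"
  shows "\<H>(orbit_word T X n) = \<H>(orbit_word T Y n)"
proof -
  note wX = simple_function_orbit_word[OF X T] and wY = simple_function_orbit_word[OF Y T]
  have "AE x in M. \<forall>i<n. X ((T ^^ i) x) = Y (S ((T ^^ i) x))"
    unfolding AE_all_countable[symmetric]
    by (intro AE_all_countable[THEN iffD2] allI AE_impI
        AE_invariant_measure[OF invariant_measure_funpow[OF T]] eq)
  then have "AE x in M. orbit_word T X n x = orbit_word T Y n (S x)"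
    using AE_space by eventually_elim (auto simp: orbit_word_def comm)
  then have "\<H>(orbit_word T X n) = \<H>(\<lambda>x. orbit_word T Y n (S x))"
    by (intro entropy_cong_AE wX simple_function_measure_preserving[OF wY]
        invariant_measure_measurable S)
  then show ?thesis
    using entropy_measure_preserving[OF wY S] by simp
qed

lemma zero_entropy_imp_tail_event:
  assumes A: "A \<in> sets M" and T: "invariant_measure M T"
    and h: "(\<lambda>n. \<H>(orbit_word T (\<lambda>x. x \<in> A) n) / real n) \<longlonglongrightarrow> 0"
  shows "tail_event M T A"
proof -
  \<comment> \<open>Zero entropy of \<open>B\<close> is part of the induction, so that
    \<open>zero_entropy_event_factor\<close> applies again at the next step.\<close>
  have "\<exists>B\<in>sets M. (AE x in M. x \<in> A \<longleftrightarrow> (T ^^ n) x \<in> B) \<and>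
      (\<lambda>n. \<H>(orbit_word T (\<lambda>x. x \<in> B) n) / real n) \<longlonglongrightarrow> 0" for n
  proof (induction n)
    case 0
    then show ?case using A h by auto
  next
    case (Suc n)
    then obtain B where B: "B \<in> sets M" and AE1: "AE x in M. x \<in> A \<longleftrightarrow> (T ^^ n) x \<in> B"
      and hB: "(\<lambda>n. \<H>(orbit_word T (\<lambda>x. x \<in> B) n) / real n) \<longlonglongrightarrow> 0" by blast
    obtain C where C: "C \<in> sets M" and AE2: "AE x in M. x \<in> B \<longleftrightarrow> T x \<in> C"
      using zero_entropy_event_factor[OF B T hB] by blast
    have "AE x in M. x \<in> A \<longleftrightarrow> (T ^^ Suc n) x \<in> C"
      using AE1 AE_invariant_measure[OF invariant_measure_funpow[OF T] AE2, of n]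
      by eventually_elim simp
    moreover have "\<H>(orbit_word T (\<lambda>x. x \<in> B) m) = \<H>(orbit_word T (\<lambda>x. x \<in> C) m)" for m
      by (intro entropy_orbit_word_factor[OF _ _ T T _ AE2] simple_function_indicator_pred B C)
        (simp add: funpow_swap1)
    ultimately show ?case using C hB by auto
  qed
  then show ?thesis
    using A by (auto simp: tail_event_def)
qed

text \<open>An explicit modulus of continuity at 0. With \<open>p = prob D\<close>, the term
  \<open>- p ln p\<close> is at most \<open>2 sqrt p\<close>, by \<open>- ln s <= 1 / s\<close> at
  \<open>s = sqrt p\<close>, and the complement contributes at most \<open>p\<close>, hence at most
  \<open>sqrt p\<close>.\<close>

lemma entropy_event_le_sqrt:
  assumes D: "D \<in> sets M"
  shows "ln b * \<H>(\<lambda>x. x \<in> D) \<le> 3 * sqrt (prob D)"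
proof -
  have lnb: "ln b > 0" using b_gt_1 by simp
  let ?p = "prob D"
  have T: "(\<lambda>x. x \<in> D) -` {True} \<inter> space M = D" and F: "(\<lambda>x. x \<in> D) -` {False} \<inter> space M = space M - D"
    using sets.sets_into_space[OF D] by auto
  have "ln b * \<H>(\<lambda>x. x \<in> D) = - (?p * ln ?p) - (1 - ?p) * ln (1 - ?p)"
    using lnb
    by (subst entropy_eq_sum[OF simple_function_indicator_pred[OF D], of "{True, False}"])
       (auto simp: T F prob_compl[OF D] log_def field_simps)
  moreover have "- (?p * ln ?p) \<le> 2 * sqrt ?p"
  proof (cases "?p = 0")
    case False
    then have pos: "0 < sqrt ?p" by (simp add: zero_less_measure_iff)
    have "- ln (sqrt ?p) = ln (1 / sqrt ?p)"
      using pos by (simp add: ln_div)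
    also have "\<dots> \<le> 1 / sqrt ?p"
      using ln_le_minus_one[of "1 / sqrt ?p"] pos by simp
    finally have "?p * (- ln (sqrt ?p)) \<le> ?p * (1 / sqrt ?p)"
      by (intro mult_left_mono) auto
    also have "\<dots> = sqrt ?p" by (simp add: real_div_sqrt)
    finally show ?thesis using pos by (simp add: ln_sqrt)
  qed simp
  moreover have "- ((1 - ?p) * ln (1 - ?p)) \<le> ?p"
  proof (cases "?p = 1")
    case False
    then have pos: "0 < 1 - ?p" using prob_le_1[of D] by linarith
    have "- ln (1 - ?p) = ln (1 / (1 - ?p))"
      using pos by (simp add: ln_div)
    also have "\<dots> \<le> 1 / (1 - ?p) - 1"
      using ln_le_minus_one[of "1 / (1 - ?p)"] pos by simp
    finally have "(1 - ?p) * (- ln (1 - ?p)) \<le> (1 - ?p) * (1 / (1 - ?p) - 1)"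
      using pos by (intro mult_left_mono) auto
    also have "\<dots> = ?p" using pos by (simp add: field_simps)
    finally show ?thesis by simp
  qed simp
  moreover have "?p \<le> sqrt ?p"
    using sqrt_le_D[of ?p ?p] prob_le_1[of D] by (intro real_le_rsqrt) (simp add: power2_eq_square mult_left_le)
  ultimately show ?thesis by linarith
qed

end

section \<open>Tail events under a second, commuting map\<close>

context information_space
begin

text \<open>Once the guess is known, the event and the error of the guess carry the same
  information, and an error of small probability has small entropy.\<close>

lemma generates_conditional_entropy:
  assumes gen: "generates M T X" and X: "simple_function M X" and T: "invariant_measure M T"
    and A: "A \<in> sets M" and e: "0 < e"
  shows "\<exists>k. \<forall>j\<ge>k. \<H>(\<lambda>x. x \<in> A \<bar> orbit_word T X j) < e"
proof -
  note w = simple_function_orbit_word[OF X T] and sA = simple_function_indicator_pred[OF A]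
  have lnb: "ln b > 0" using b_gt_1 by simp
  \<comment> \<open>The tolerance is the one for which \<open>entropy_event_le_sqrt\<close> yields
    an entropy below \<open>e\<close>.\<close>
  obtain k G where kG: "prob {x \<in> space M. (x \<in> A) \<noteq> (orbit_word T X k x \<in> G)} < (e * ln b / 3)\<^sup>2"
    using gen A e lnb unfolding generates_def approximable_def by (meson mult_pos_pos divide_pos_pos zero_less_power zero_less_numeral)
  define D where "D = {x \<in> space M. (x \<in> A) \<noteq> (orbit_word T X k x \<in> G)}"
  have D: "D \<in> sets M"
    using simple_function_sets[OF simple_function_Pair[OF sA w[of k]], of "{(a, v). a \<noteq> (v \<in> G)}"]
    by (simp add: D_def)
  note sD = simple_function_indicator_pred[OF D]
  have sG: "simple_function M (\<lambda>x. orbit_word T X k x \<in> G)"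
    by (rule simple_function_compose1[OF w])
  have "sqrt (prob D) < e * ln b / 3"
    using kG e lnb by (intro real_less_lsqrt) (auto simp: D_def)
  then have "ln b * \<H>(\<lambda>x. x \<in> D) < ln b * e"
    using entropy_event_le_sqrt[OF D] by (simp add: field_simps)
  then have small: "\<H>(\<lambda>x. x \<in> D) < e"
    using lnb by simp
  have "\<H>(\<lambda>x. x \<in> A \<bar> orbit_word T X j) < e" if "j \<ge> k" for j
  proof -
    have "\<H>(\<lambda>x. x \<in> A \<bar> orbit_word T X j) \<le> \<H>(\<lambda>x. x \<in> A \<bar> \<lambda>x. orbit_word T X k x \<in> G)"
    proof (rule conditional_entropy_antimono[OF sA w sG])
      fix x y assume "orbit_word T X j x = orbit_word T X j y"
      then have "orbit_word T X k x = orbit_word T X k y"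
        using that by (simp add: orbit_word_eq_iff)
      then show "(orbit_word T X k x \<in> G) = (orbit_word T X k y \<in> G)" by simp
    qed
    also have "\<H>(\<lambda>x. (orbit_word T X k x \<in> G, x \<in> A)) = \<H>(\<lambda>x. (orbit_word T X k x \<in> G, x \<in> D))"
      by (intro entropy_determined_eq simple_function_Pair sG sA sD) (auto simp: D_def)
    then have "\<H>(\<lambda>x. x \<in> A \<bar> \<lambda>x. orbit_word T X k x \<in> G) = \<H>(\<lambda>x. x \<in> D \<bar> \<lambda>x. orbit_word T X k x \<in> G)"
      by (simp add: conditional_entropy_eq_diff sG sA sD)
    also have "\<dots> \<le> \<H>(\<lambda>x. x \<in> D)"
      by (rule conditional_entropy_less_eq_entropy[OF sD sG])
    finally show ?thesis using small by simp
  qed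
  then show ?thesis by blast
qed

lemma conditional_entropy_orbit_word_Suc_le:
  assumes X: "simple_function M X" and S: "invariant_measure M S" and Y: "simple_function M Y"
  shows "\<H>(orbit_word S X (Suc n) \<bar> Y) \<le> \<H>(orbit_word S X n \<bar> Y) + \<H>(\<lambda>x. X ((S ^^ n) x) \<bar> Y)"
proof -
  note w = simple_function_orbit_word[OF X S]
  note Xn = simple_function_measure_preserving[OF X
      invariant_measure_measurable[OF invariant_measure_funpow[OF S]], of n]
  have "\<H>(orbit_word S X (Suc n) \<bar> Y) \<le> \<H>(\<lambda>x. (orbit_word S X n x, X ((S ^^ n) x)) \<bar> Y)"
    by (intro conditional_entropy_mono w simple_function_Pair Xn Y) (simp add: orbit_word_Suc)
  also have "\<dots> \<le> \<H>(orbit_word S X n \<bar> Y) + \<H>(\<lambda>x. X ((S ^^ n) x) \<bar> Y)"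
    by (rule conditional_entropy_Pair_le[OF w Xn Y])
  finally show ?thesis .
qed

lemma conditional_entropy_const:
  assumes "simple_function M Y"
  shows "\<H>(\<lambda>_. c \<bar> Y) = 0"
  using conditional_entropy_less_eq_entropy[of "\<lambda>_. c" Y] conditional_entropy_nonneg[of "\<lambda>_. c" Y] assms
  by (intro antisym) (simp_all add: entropy_const)

text \<open>Every letter of the \<open>S\<close>-word of \<open>A\<close> is the indicator of a
  preimage of \<open>A\<close>, again an event approximated by \<open>T\<close>-words; the
  conditional entropies of the letters add up.\<close>

lemma generates_conditional_entropy_word:
  assumes gen: "generates M T X" and X: "simple_function M X"
    and T: "invariant_measure M T" and S: "invariant_measure M S" and A: "A \<in> sets M"
  shows "0 < e \<Longrightarrow> \<exists>k. \<forall>j\<ge>k. \<H>(orbit_word S (\<lambda>x. x \<in> A) n \<bar> orbit_word T X j) < e"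
proof (induction n arbitrary: e)
  case 0
  then show ?case
    by (simp add: conditional_entropy_const simple_function_orbit_word[OF X T])
next
  case (Suc n)
  note w = simple_function_orbit_word[OF X T] and sA = simple_function_indicator_pred[OF A]
  note mn = invariant_measure_measurable[OF invariant_measure_funpow[OF S], of n]
  let ?B = "(S ^^ n) -` A \<inter> space M"
  have B: "?B \<in> sets M" using mn A by (rule measurable_sets)
  obtain k1 where k1: "\<And>j. j \<ge> k1 \<Longrightarrow> \<H>(orbit_word S (\<lambda>x. x \<in> A) n \<bar> orbit_word T X j) < e / 2"
    using Suc.IH[of "e / 2"] Suc.prems by auto
  obtain k2 where k2: "\<And>j. j \<ge> k2 \<Longrightarrow> \<H>(\<lambda>x. x \<in> ?B \<bar> orbit_word T X j) < e / 2"
    using generates_conditional_entropy[OF gen X T B, of "e / 2"] Suc.prems by auto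
  have "\<H>(orbit_word S (\<lambda>x. x \<in> A) (Suc n) \<bar> orbit_word T X j) < e" if "j \<ge> max k1 k2" for j
  proof -
    have "\<H>(\<lambda>x. (S ^^ n) x \<in> A \<bar> orbit_word T X j) \<le> \<H>(\<lambda>x. x \<in> ?B \<bar> orbit_word T X j)"
      by (intro conditional_entropy_mono simple_function_measure_preserving[OF sA mn]
          simple_function_indicator_pred[OF B] w) auto
    then show ?thesis
      using conditional_entropy_orbit_word_Suc_le[OF sA S w[of j], of n] k1[of j] k2[of j] that by simp
  qed
  then show ?case by blast
qed

text \<open>A tail event of \<open>T\<close> lies in \<open>T\<^sup>-\<^sup>m\<B>\<close> for every \<open>m\<close>, so conditioning on finitely many of
  them does not push the entropy of \<open>m\<close> steps of the generator below \<open>m\<close> times its rate.\<close>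

lemma entropy_given_tail_events:
  assumes X: "simple_function M X" and T: "invariant_measure M T" and S: "invariant_measure M S"
    and comm: "\<And>x i j. x \<in> space M \<Longrightarrow> (S ^^ i) ((T ^^ j) x) = (T ^^ j) ((S ^^ i) x)"
    and gen: "generates M T X" and A: "tail_event M T A"
    and h: "(\<lambda>n. \<H>(orbit_word T X n) / real n) \<longlonglongrightarrow> h"
  shows "\<H>(orbit_word S (\<lambda>x. x \<in> A) n) + real m * h
    \<le> \<H>(\<lambda>x. (orbit_word T X m x, orbit_word S (\<lambda>x. x \<in> A) n x))"
proof (rule field_le_epsilon)
  fix e :: real assume "e > 0"
  have A': "A \<in> sets M" using A by (simp add: tail_event_def)
  obtain B where B: "B \<in> sets M" and AE: "AE x in M. x \<in> A \<longleftrightarrow> (T ^^ m) x \<in> B"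
    using A by (auto simp: tail_event_def)
  note sA = simple_function_indicator_pred[OF A'] and sB = simple_function_indicator_pred[OF B]
  note wX = simple_function_orbit_word[OF X T]
    and wA = simple_function_orbit_word[OF sA S] and wB = simple_function_orbit_word[OF sB S]
  note Tm = invariant_measure_funpow[OF T, of m]
  note mT = invariant_measure_measurable[OF Tm]
  note wXT = simple_function_measure_preserving[OF wX mT] and wBT = simple_function_measure_preserving[OF wB mT]
  let ?a = "orbit_word S (\<lambda>x. x \<in> A) n" and ?g = "orbit_word S (\<lambda>x. x \<in> B) n"
  \<comment> \<open>The first \<open>k\<close> letters along \<open>T\<close> almost determine the
    \<open>S\<close>-word of \<open>B\<close>. The error \<open>e\<close> is the only loss in the
    estimate and is arbitrary.\<close>
  obtain k where k: "\<H>(?g \<bar> orbit_word T X k) < e"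
    using generates_conditional_entropy_word[OF gen X T S B \<open>e > 0\<close>] by blast
  have "AE x in M. \<forall>i<n. (S ^^ i) x \<in> A \<longleftrightarrow> (T ^^ m) ((S ^^ i) x) \<in> B"
    by (intro AE_all_countable[THEN iffD2] allI AE_impI
        AE_invariant_measure[OF invariant_measure_funpow[OF S]] AE)
  then have AEg: "AE x in M. ?a x = ?g ((T ^^ m) x)"
    using AE_space by eventually_elim (auto simp: orbit_word_def comm)
  \<comment> \<open>A word of length \<open>m + k\<close> consists of \<open>m\<close> letters at
    \<open>x\<close> and \<open>k\<close> letters at \<open>(T ^^ m) x\<close>. Submodularity is
    applied given the \<open>B\<close>-word at \<open>(T ^^ m) x\<close>, which almost surely is the
    \<open>A\<close>-word at \<open>x\<close>; the entropy of the \<open>k\<close> letters then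
    cancels.\<close>
  have "\<H>(orbit_word T X k) + real m * h + \<H>(?g) \<le> \<H>(orbit_word T X (m + k)) + \<H>(?g)"
    using entropy_orbit_word_add_ge[OF X T h, of k m] by (simp add: add.commute)
  also have "\<H>(orbit_word T X (m + k))
      \<le> \<H>(\<lambda>x. (orbit_word T X m x, orbit_word T X k ((T ^^ m) x), ?g ((T ^^ m) x)))"
    by (intro entropy_determined simple_function_Pair wX wXT wBT) (auto simp: orbit_word_add)
  also have "\<H>(?g) = \<H>(\<lambda>x. ?g ((T ^^ m) x))"
    using entropy_measure_preserving[OF wB Tm] by simp
  also have "\<H>(\<lambda>x. (orbit_word T X m x, orbit_word T X k ((T ^^ m) x), ?g ((T ^^ m) x)))
        + \<H>(\<lambda>x. ?g ((T ^^ m) x))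
      \<le> \<H>(\<lambda>x. (orbit_word T X m x, ?g ((T ^^ m) x)))
        + \<H>(\<lambda>x. (orbit_word T X k ((T ^^ m) x), ?g ((T ^^ m) x)))"
    by (rule entropy_submodular[OF wX wXT wBT])
  also have "\<H>(\<lambda>x. (orbit_word T X m x, ?g ((T ^^ m) x))) = \<H>(\<lambda>x. (orbit_word T X m x, ?a x))"
    using AEg by (intro entropy_cong_AE simple_function_Pair wX wBT wA) auto
  also have "\<H>(\<lambda>x. (orbit_word T X k ((T ^^ m) x), ?g ((T ^^ m) x)))
      = \<H>(\<lambda>x. (orbit_word T X k x, ?g x))"
    by (rule entropy_measure_preserving[OF simple_function_Pair[OF wX wB] Tm])
  also have "\<dots> = \<H>(orbit_word T X k) + \<H>(?g \<bar> orbit_word T X k)"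
    by (rule entropy_chain_rule[OF wX wB])
  finally have "real m * h + \<H>(?g) \<le> \<H>(\<lambda>x. (orbit_word T X m x, ?a x)) + e"
    using k entropy_measure_preserving[OF wB Tm, of n] by simp
  moreover have "\<H>(?a) = \<H>(?g)"
    using entropy_cong_AE[OF wA wBT AEg] entropy_measure_preserving[OF wB Tm] by simp
  ultimately show "\<H>(?a) + real m * h \<le> \<H>(\<lambda>x. (orbit_word T X m x, ?a x)) + e"
    by simp
qed

text \<open>The letter of \<open>A\<close> at time \<open>i\<close> is predicted from the
  \<open>k\<close> letters of \<open>X\<close> starting at time \<open>i\<close>. For
  \<open>i < n\<close> these lie in the word of length \<open>n + k\<close>, and by invariance each
  prediction has the same cost.\<close>

lemma entropy_join_with_event_le:
  assumes X: "simple_function M X" and S: "invariant_measure M S" and A: "A \<in> sets M"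
  shows "\<H>(\<lambda>x. (orbit_word S X n x, orbit_word S (\<lambda>x. x \<in> A) n x))
    \<le> \<H>(orbit_word S X (n + k)) + real n * \<H>(\<lambda>x. x \<in> A \<bar> orbit_word S X k)"
proof -
  note sA = simple_function_indicator_pred[OF A]
  note wX = simple_function_orbit_word[OF X S] and wA = simple_function_orbit_word[OF sA S]
  have "\<H>(orbit_word S (\<lambda>x. x \<in> A) i \<bar> orbit_word S X (n + k))
      \<le> real i * \<H>(\<lambda>x. x \<in> A \<bar> orbit_word S X k)" if "i \<le> n" for i
    using that
  proof (induction i)
    case 0
    then show ?case by (simp add: conditional_entropy_const[OF wX])
  next
    case (Suc i)
    note Si = invariant_measure_funpow[OF S, of i]
    note mi = invariant_measure_measurable[OF Si]
    have "\<H>(\<lambda>x. (S ^^ i) x \<in> A \<bar> orbit_word S X (n + k))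
        \<le> \<H>(\<lambda>x. (S ^^ i) x \<in> A \<bar> \<lambda>x. orbit_word S X k ((S ^^ i) x))"
    proof (rule conditional_entropy_antimono[OF simple_function_measure_preserving[OF sA mi] wX
          simple_function_measure_preserving[OF wX mi]])
      fix x y assume "orbit_word S X (n + k) x = orbit_word S X (n + k) y"
      then have "orbit_word S X (i + k) x = orbit_word S X (i + k) y"
        using Suc.prems by (simp add: orbit_word_eq_iff)
      then show "orbit_word S X k ((S ^^ i) x) = orbit_word S X k ((S ^^ i) y)"
        by (simp add: orbit_word_add)
    qed
    also have "\<dots> = \<H>(\<lambda>x. x \<in> A \<bar> orbit_word S X k)"
      by (rule conditional_entropy_measure_preserving[OF sA wX Si])
    finally show ?case
      using Suc conditional_entropy_orbit_word_Suc_le[OF sA S wX[of "n + k"], of i]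
      by (simp add: algebra_simps)
  qed
  from this[of n] have le: "\<H>(orbit_word S (\<lambda>x. x \<in> A) n \<bar> orbit_word S X (n + k))
      \<le> real n * \<H>(\<lambda>x. x \<in> A \<bar> orbit_word S X k)" by simp
  have "\<H>(\<lambda>x. (orbit_word S X n x, orbit_word S (\<lambda>x. x \<in> A) n x))
      \<le> \<H>(\<lambda>x. (orbit_word S X (n + k) x, orbit_word S (\<lambda>x. x \<in> A) n x))"
    by (intro entropy_determined simple_function_Pair wX wA) (auto simp: orbit_word_eq_iff)
  also have "\<dots> = \<H>(orbit_word S X (n + k)) + \<H>(orbit_word S (\<lambda>x. x \<in> A) n \<bar> orbit_word S X (n + k))"
    by (rule entropy_chain_rule[OF wX wA])
  finally show ?thesis using le by simp
qed

text \<open>The tail property bounds the joint entropy of the \<open>T\<close>-word and the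
  \<open>A\<close>-word from below by \<open>m * h\<close> plus the entropy of the
  \<open>A\<close>-word. Trading the \<open>T\<close>-word for the \<open>S\<close>-word and back
  bounds it from above by \<open>m * h\<close> plus small errors, and \<open>m * h\<close>
  cancels.\<close>

lemma tail_event_imp_zero_entropy:
  fixes m n :: "nat \<Rightarrow> nat"
  assumes X: "simple_function M X" and T: "invariant_measure M T" and S: "invariant_measure M S"
    and comm: "\<And>x i j. x \<in> space M \<Longrightarrow> (S ^^ i) ((T ^^ j) x) = (T ^^ j) ((S ^^ i) x)"
    and genT: "generates M T X" and genS: "generates M S X" and A: "tail_event M T A"
    and n: "filterlim n at_top sequentially" and m: "filterlim m at_top sequentially"
    and C: "0 \<le> C" "\<And>l. real (m l) \<le> C * real (n l)"
    and ST: "\<And>e. e > 0 \<Longrightarrow> \<forall>\<^sub>F l in sequentially.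
       \<H>(orbit_word S X (n l) \<bar> orbit_word T X (m l)) \<le> e * real (n l)"
    and TS: "\<And>e. e > 0 \<Longrightarrow> \<forall>\<^sub>F l in sequentially.
       \<H>(orbit_word T X (m l) \<bar> orbit_word S X (n l)) \<le> e * real (n l)"
  shows "(\<lambda>k. \<H>(orbit_word S (\<lambda>x. x \<in> A) k) / real k) \<longlonglongrightarrow> 0"
proof -
  have A': "A \<in> sets M" using A by (simp add: tail_event_def)
  note sA = simple_function_indicator_pred[OF A']
  note wT = simple_function_orbit_word[OF X T] and wS = simple_function_orbit_word[OF X S]
    and wA = simple_function_orbit_word[OF sA S]
  obtain h where h: "(\<lambda>n. \<H>(orbit_word T X n) / real n) \<longlonglongrightarrow> h"
    by (rule entropy_orbit_word_increments[OF X T])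
  obtain hA where hA0: "0 \<le> hA" and hA: "(\<lambda>k. \<H>(orbit_word S (\<lambda>x. x \<in> A) k) / real k) \<longlonglongrightarrow> hA"
    by (rule entropy_orbit_word_increments[OF sA S])
  \<comment> \<open>Three errors \<open>e * n\<close> arise from the two exchanges of words and from
    predicting \<open>A\<close> by \<open>k\<close> letters. The deviation of the
    \<open>T\<close>-word from its rate costs \<open>e * m\<close>, at most
    \<open>C * e * n\<close>.\<close>
  have bound: "hA \<le> (C + 3) * e" if e: "e > 0" for e
  proof -
    obtain k where k: "\<H>(\<lambda>x. x \<in> A \<bar> orbit_word S X k) < e"
      using generates_conditional_entropy[OF genS X S A' e] by blast
    have n0: "\<forall>\<^sub>F l in sequentially. 0 < n l"
      by (rule eventually_compose_filterlim[OF eventually_gt_at_top n])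
    have m0: "\<forall>\<^sub>F l in sequentially. 0 < m l"
      by (rule eventually_compose_filterlim[OF eventually_gt_at_top m])
    have "\<forall>\<^sub>F j in sequentially. \<H>(orbit_word T X j) / real j < h + e"
      using order_tendstoD(2)[OF h, of "h + e"] e by simp
    then have mh: "\<forall>\<^sub>F l in sequentially. \<H>(orbit_word T X (m l)) / real (m l) < h + e"
      using m by (rule eventually_compose_filterlim)
    have "\<forall>\<^sub>F l in sequentially. \<H>(orbit_word S (\<lambda>x. x \<in> A) (n l)) / real (n l)
        \<le> (C + 3) * e + \<H>(orbit_word S X k) / real (n l)"
      using ST[OF e] TS[OF e] n0 m0 mh
    proof eventually_elim
      case (elim l)
      let ?n = "n l" and ?m = "m l"
      let ?a = "orbit_word S (\<lambda>x. x \<in> A) ?n"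
      have "\<H>(?a) + real ?m * h \<le> \<H>(\<lambda>x. (orbit_word T X ?m x, ?a x))"
        by (rule entropy_given_tail_events[OF X T S comm genT A h])
      also have "\<dots> \<le> \<H>(\<lambda>x. ((orbit_word S X ?n x, ?a x), orbit_word T X ?m x))"
        by (intro entropy_determined simple_function_Pair wT wS wA) auto
      also have "\<dots> = \<H>(\<lambda>x. (orbit_word S X ?n x, ?a x))
          + \<H>(orbit_word T X ?m \<bar> \<lambda>x. (orbit_word S X ?n x, ?a x))"
        by (rule entropy_chain_rule[OF simple_function_Pair[OF wS wA] wT])
      also have "\<H>(orbit_word T X ?m \<bar> \<lambda>x. (orbit_word S X ?n x, ?a x))
          \<le> \<H>(orbit_word T X ?m \<bar> orbit_word S X ?n)"
        by (intro conditional_entropy_antimono simple_function_Pair wT wS wA) auto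
      also have "\<dots> \<le> e * real ?n"
        by fact
      also have "\<H>(\<lambda>x. (orbit_word S X ?n x, ?a x))
          \<le> \<H>(orbit_word S X (?n + k)) + real ?n * \<H>(\<lambda>x. x \<in> A \<bar> orbit_word S X k)"
        by (rule entropy_join_with_event_le[OF X S A'])
      also have "real ?n * \<H>(\<lambda>x. x \<in> A \<bar> orbit_word S X k) \<le> real ?n * e"
        using k by (intro mult_left_mono) auto
      also have "\<H>(orbit_word S X (?n + k)) \<le> \<H>(orbit_word S X ?n) + \<H>(orbit_word S X k)"
        by (rule entropy_orbit_word_add_le[OF X S])
      also have "\<H>(orbit_word S X ?n) \<le> \<H>(\<lambda>x. (orbit_word T X ?m x, orbit_word S X ?n x))"
        by (intro entropy_determined simple_function_Pair wT wS) auto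
      also have "\<dots> = \<H>(orbit_word T X ?m) + \<H>(orbit_word S X ?n \<bar> orbit_word T X ?m)"
        by (rule entropy_chain_rule[OF wT wS])
      also have "\<H>(orbit_word S X ?n \<bar> orbit_word T X ?m) \<le> e * real ?n"
        by fact
      also have "\<H>(orbit_word T X ?m) \<le> real ?m * h + real ?m * e"
        using elim by (simp add: field_simps)
      also have "real ?m * e \<le> (C * real ?n) * e"
        using C(2)[of l] e by (intro mult_right_mono) auto
      finally have "\<H>(?a) \<le> (C + 3) * e * real ?n + \<H>(orbit_word S X k)"
        by (simp add: algebra_simps)
      then show ?case using elim by (simp add: field_simps)
    qed
    moreover have "(\<lambda>l. \<H>(orbit_word S (\<lambda>x. x \<in> A) (n l)) / real (n l)) \<longlonglongrightarrow> hA"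
      using filterlim_compose[OF hA n] by simp
    moreover have "(\<lambda>l. (C + 3) * e + \<H>(orbit_word S X k) / real (n l)) \<longlonglongrightarrow> (C + 3) * e + 0"
      using filterlim_compose[OF lim_const_over_n n] by (intro tendsto_add tendsto_const) simp
    ultimately show ?thesis
      using tendsto_le[OF sequentially_bot] by fastforce
  qed
  have "hA \<le> 0"
  proof (rule field_le_epsilon)
    fix e :: real assume "e > 0"
    then show "hA \<le> 0 + e"
      using bound[of "e / (C + 3)"] C(1) by simp
  qed
  with hA0 hA show ?thesis by simp
qed

end

section \<open>Level sets and the entropy of partitions\<close>

text \<open>Links partitions given as sets of sets with the functions whose entropy is
  studied.\<close>

definition level_sets :: "'x set \<Rightarrow> ('x \<Rightarrow> 'c) \<Rightarrow> 'x set set" where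
  "level_sets X g = (\<lambda>x. {y \<in> X. g y = g x}) ` X"

lemma zero_partition_eq_level_sets: "zero_partition W = level_sets W (\<lambda>x. x (0, 0))"
  by (simp add: zero_partition_def level_sets_def)

text \<open>A nonempty cell of the join passes through some \<open>x\<close>, and each
  \<open>p i\<close> is then the fibre through the \<open>i\<close>-th iterate of \<open>x\<close>.
  Removing the empty set from \<open>P\<close> admits two-set partitions with an empty half.\<close>

lemma iterated_join_eq_level_sets:
  assumes T: "\<And>x. x \<in> X \<Longrightarrow> T x \<in> X" and P: "P - {{}} = level_sets X g"
  shows "iterated_join X T P n = level_sets X (orbit_word T g n)"
proof -
  have Ti: "(T ^^ i) x \<in> X" if "x \<in> X" for i x
    by (induction i) (use that T in auto)
  show ?thesis
  proof (intro equalityI subsetI)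
    fix A assume "A \<in> iterated_join X T P n"
    then obtain p x where p: "\<And>i. i < n \<Longrightarrow> p i \<in> P" and A: "A = {x \<in> X. \<forall>i<n. (T ^^ i) x \<in> p i}"
      and x: "x \<in> A"
      unfolding iterated_join_def by blast
    have x': "x \<in> X" "\<And>i. i < n \<Longrightarrow> (T ^^ i) x \<in> p i" using x A by auto
    have pi: "p i = {y \<in> X. g y = g ((T ^^ i) x)}" if i: "i < n" for i
    proof -
      have "p i \<in> level_sets X g" using p[OF i] x'(2)[OF i] unfolding P[symmetric] by blast
      then obtain z where z: "p i = {y \<in> X. g y = g z}"
        by (auto simp: level_sets_def)
      have "g ((T ^^ i) x) = g z"
        using x'(2)[OF i] unfolding z by blast
      then show ?thesis using z by simp
    qed
    have "A = {y \<in> X. orbit_word T g n y = orbit_word T g n x}"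
      unfolding A orbit_word_eq_iff using pi Ti by auto
    then show "A \<in> level_sets X (orbit_word T g n)" using x'(1) by (auto simp: level_sets_def)
  next
    fix A assume "A \<in> level_sets X (orbit_word T g n)"
    then obtain x where x: "x \<in> X" and A: "A = {y \<in> X. orbit_word T g n y = orbit_word T g n x}"
      by (auto simp: level_sets_def)
    let ?p = "\<lambda>i. {y \<in> X. g y = g ((T ^^ i) x)}"
    have "?p i \<in> P" for i
    proof -
      have "?p i \<in> level_sets X g" using Ti[OF x] by (auto simp: level_sets_def)
      then show ?thesis by (auto simp: P[symmetric])
    qed
    moreover have "A = {y \<in> X. \<forall>i<n. (T ^^ i) y \<in> ?p i}"
      unfolding A orbit_word_eq_iff using Ti by auto
    moreover have "A \<noteq> {}" using x A by auto
    ultimately show "A \<in> iterated_join X T P n"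
      unfolding iterated_join_def by (intro DiffI CollectI exI[of _ ?p]) auto
  qed
qed

lemma two_set_partition_eq_level_sets:
  "A \<subseteq> X \<Longrightarrow> {A, X - A} - {{}} = level_sets X (\<lambda>x. x \<in> A)"
proof (intro equalityI subsetI)
  fix B assume A: "A \<subseteq> X" and "B \<in> {A, X - A} - {{}}"
  then obtain x where "x \<in> B" "B = A \<or> B = X - A" by auto
  then show "B \<in> level_sets X (\<lambda>x. x \<in> A)"
    unfolding level_sets_def using A by (intro image_eqI[of _ _ x]) auto
qed (auto simp: level_sets_def)

text \<open>Distinct values of \<open>X\<close> on a fibre of \<open>Y\<close> have distinct
  preimages, all of which meet this fibre. Finiteness makes \<open>card\<close> and
  \<open>Max\<close> meaningful.\<close>

lemma max_intersections_ge:
  assumes X: "finite (X ` \<Omega>)" and Y: "finite (Y ` \<Omega>)" and x: "x \<in> \<Omega>"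
  shows "card (X ` {y \<in> \<Omega>. Y y = Y x}) \<le> max_intersections (level_sets \<Omega> Y) (level_sets \<Omega> X)"
proof -
  have fin: "finite (level_sets \<Omega> g)" if "finite (g ` \<Omega>)" for g :: "_ \<Rightarrow> 'd"
  proof -
    have "level_sets \<Omega> g = (\<lambda>v. {y \<in> \<Omega>. g y = v}) ` g ` \<Omega>"
      by (auto simp: level_sets_def)
    then show ?thesis using that by simp
  qed
  let ?p = "{y \<in> \<Omega>. Y y = Y x}"
  have "card (X ` ?p) \<le> card {q \<in> level_sets \<Omega> X. ?p \<inter> q \<noteq> {}}"
  proof (rule card_inj_on_le[where f = "\<lambda>v. {z \<in> \<Omega>. X z = v}"])
    show "inj_on (\<lambda>v. {z \<in> \<Omega>. X z = v}) (X ` ?p)"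
      by (auto simp: inj_on_def set_eq_iff)
    show "(\<lambda>v. {z \<in> \<Omega>. X z = v}) ` X ` ?p \<subseteq> {q \<in> level_sets \<Omega> X. ?p \<inter> q \<noteq> {}}"
      by (auto simp: level_sets_def)
    show "finite {q \<in> level_sets \<Omega> X. ?p \<inter> q \<noteq> {}}"
      using fin[OF X] by simp
  qed
  also have "\<dots> \<le> max_intersections (level_sets \<Omega> Y) (level_sets \<Omega> X)"
    unfolding max_intersections_def
  proof (rule Max_ge)
    show "finite ((\<lambda>p. card {q \<in> level_sets \<Omega> X. p \<inter> q \<noteq> {}}) ` level_sets \<Omega> Y)"
      using fin[OF Y] by simp
    show "card {q \<in> level_sets \<Omega> X. ?p \<inter> q \<noteq> {}}
        \<in> (\<lambda>p. card {q \<in> level_sets \<Omega> X. p \<inter> q \<noteq> {}}) ` level_sets \<Omega> Y"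
      using x by (intro imageI) (auto simp: level_sets_def)
  qed
  finally show ?thesis .
qed

section \<open>From counting bounds and partitions to entropy\<close>

lemma subexponential_ln_le:
  assumes f: "subexponential f" and pos: "\<And>l. 0 < f l" and c: "c > 0"
  shows "\<forall>\<^sub>F l in sequentially. ln (real (f l)) \<le> c * real l"
proof -
  have "(\<lambda>l. real (f l)) \<in> o(\<lambda>l. exp (c * real l))"
    using f c by (simp add: subexponential_def)
  from landau_o.smallD[OF this zero_less_one] show ?thesis
  proof eventually_elim
    case (elim l)
    then have "ln (real (f l)) \<le> ln (exp (c * real l))"
      using pos[of l] by (intro ln_mono) auto
    then show ?case by simp
  qed
qed

lemma (in information_space) conditional_entropy_le_log_max_intersections:
  assumes X: "simple_function M X" and Y: "simple_function M Y"
  shows "\<H>(X \<bar> Y) \<le> log b (real (max_intersections (level_sets (space M) Y) (level_sets (space M) X)))"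
  using X Y by (intro conditional_entropy_le_log_card max_intersections_ge) (auto simp: simple_function_def)

lemma (in prob_space) max_intersections_level_sets_pos:
  assumes X: "simple_function M X" and Y: "simple_function M Y"
  shows "0 < max_intersections (level_sets (space M) Y) (level_sets (space M) X)"
proof -
  obtain x where x: "x \<in> space M" using not_empty by blast
  have "finite (X ` {y \<in> space M. Y y = Y x})"
    using X by (auto simp: simple_function_def intro: finite_subset[of _ "X ` space M"])
  then have "0 < card (X ` {y \<in> space M. Y y = Y x})"
    using x by (auto simp: card_gt_0_iff)
  also have "\<dots> \<le> max_intersections (level_sets (space M) Y) (level_sets (space M) X)"
    using X Y x by (intro max_intersections_ge) (auto simp: simple_function_def)
  finally show ?thesis .
qed

text \<open>Distinct values in the range have distinct preimages, so the sum over cells is a sum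
  over values; base \<open>exp 1\<close> matches the natural logarithm.\<close>

lemma partition_entropy_level_sets:
  assumes M: "information_space M (exp 1)" and Y: "simple_function M Y"
  shows "partition_entropy M (level_sets (space M) Y)
    = prob_space.entropy M (exp 1) (count_space (Y ` space M)) Y"
proof -
  interpret information_space M "exp 1" by fact
  have "level_sets (space M) Y = (\<lambda>v. Y -` {v} \<inter> space M) ` Y ` space M"
    by (auto simp: level_sets_def)
  moreover have "inj_on (\<lambda>v. Y -` {v} \<inter> space M) (Y ` space M)"
    by (auto simp: inj_on_def set_eq_iff)
  ultimately show ?thesis
    using Y by (simp add: partition_entropy_def sum.reindex log_def
        entropy_eq_sum[OF Y _ order_refl] simple_function_def)
qed

lemma dynamical_entropy_eq_lim:
  assumes M: "information_space M (exp 1)" and T: "invariant_measure M T" and A: "A \<in> sets M"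
  shows "dynamical_entropy M T {A, space M - A} = lim (\<lambda>n. prob_space.entropy M (exp 1)
     (count_space (orbit_word T (\<lambda>x. x \<in> A) n ` space M)) (orbit_word T (\<lambda>x. x \<in> A) n) / real n)"
proof -
  interpret information_space M "exp 1" by fact
  have "iterated_join (space M) T {A, space M - A} n = level_sets (space M) (orbit_word T (\<lambda>x. x \<in> A) n)" for n
    using measurable_space[OF invariant_measure_measurable[OF T]] sets.sets_into_space[OF A]
    by (intro iterated_join_eq_level_sets two_set_partition_eq_level_sets) auto
  then show ?thesis
    by (simp add: dynamical_entropy_def partition_entropy_level_sets[OF M]
        simple_function_orbit_word[OF simple_function_indicator_pred[OF A] T])
qed

text \<open>A value of \<open>lim\<close> alone does not imply convergence; the existence of the
  entropy rate turns the value 0 into actual convergence to 0.\<close>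

lemma dynamical_entropy_eq_0_iff:
  assumes M: "information_space M (exp 1)" and T: "invariant_measure M T" and A: "A \<in> sets M"
  shows "dynamical_entropy M T {A, space M - A} = 0 \<longleftrightarrow>
     (\<lambda>n. prob_space.entropy M (exp 1) (count_space (orbit_word T (\<lambda>x. x \<in> A) n ` space M))
        (orbit_word T (\<lambda>x. x \<in> A) n) / real n) \<longlonglongrightarrow> 0"
proof -
  interpret information_space M "exp 1" by fact
  let ?f = "\<lambda>n. entropy_Pow (orbit_word T (\<lambda>x. x \<in> A) n) / real n"
  obtain h where h: "?f \<longlonglongrightarrow> h"
    by (rule entropy_orbit_word_increments[OF simple_function_indicator_pred[OF A] T])
  have "h = 0 \<longleftrightarrow> ?f \<longlonglongrightarrow> 0"
    using h LIMSEQ_unique[OF h] by blast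
  then show ?thesis
    unfolding dynamical_entropy_eq_lim[OF assms] limI[OF h] .
qed

section \<open>Words along an axis of a subshift\<close>

lemma shift_apply: "shift v x w = x (fst w + fst v, snd w + snd v)"
  by (simp add: shift_def split: prod.split)

lemma shift_shift: "shift v (shift w x) = shift (fst v + fst w, snd v + snd w) x"
  by (rule ext) (simp add: shift_apply ac_simps)

lemma shift_funpow: "(shift v ^^ k) x = shift (k * fst v, k * snd v) x"
proof (induction k)
  case 0
  show ?case by (rule ext) (simp add: shift_apply)
next
  case (Suc k)
  then show ?case by (simp add: shift_shift)
qed

text \<open>Almost-generation only grants some countable \<open>C\<close>. A point outside
  \<open>C\<close> that shares its values has its partners in \<open>C\<close>, and each partner in
  \<open>C\<close> serves at most one point outside \<open>C\<close>, namely its image under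
  \<open>?g\<close>.\<close>

lemma countable_shared_points:
  assumes "almost_generated I W"
  shows "countable {x \<in> W. \<exists>y\<in>W. y \<noteq> x \<and> (\<forall>i\<in>I. y i = x i)}" (is "countable ?S")
proof -
  from assms have "\<exists>C\<subseteq>W. countable C \<and> (\<forall>x\<in>W - C. \<forall>y\<in>W - C. (\<forall>i\<in>I. x i = y i) \<longrightarrow> x = y)"
    unfolding almost_generated_def by (rule conjunct2)
  then obtain C where C: "C \<subseteq> W" "countable C"
    and C': "\<forall>x\<in>W - C. \<forall>y\<in>W - C. (\<forall>i\<in>I. x i = y i) \<longrightarrow> x = y"
    by (elim exE conjE)
  have inj: "x = y" if "x \<in> W - C" "y \<in> W - C" "\<forall>i\<in>I. x i = y i" for x y
    using C'[rule_format, OF that(1,2)] that(3) by blast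
  let ?g = "\<lambda>c. SOME x. x \<in> W - C \<and> (\<forall>i\<in>I. c i = x i)"
  have "?S \<subseteq> C \<union> ?g ` C"
  proof
    fix x assume "x \<in> ?S"
    then obtain y where x: "x \<in> W" and y: "y \<in> W" "y \<noteq> x" "\<forall>i\<in>I. y i = x i" by auto
    show "x \<in> C \<union> ?g ` C"
    proof (cases "x \<in> C")
      case False
      then have "y \<in> C" using inj[of x y] x y by auto
      have *: "x \<in> W - C \<and> (\<forall>i\<in>I. y i = x i)" using x y False by simp
      then have g: "?g y \<in> W - C \<and> (\<forall>i\<in>I. y i = ?g y i)" by (rule someI[of "\<lambda>x. x \<in> W - C \<and> (\<forall>i\<in>I. y i = x i)"])
      have "?g y = x" by (rule inj) (use * g in auto)
      with \<open>y \<in> C\<close> show ?thesis by blast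
    qed simp
  qed
  then show ?thesis by (rule countable_subset) (simp add: C(2))
qed

section \<open>Approximable events under complements and countable unions\<close>

context information_space
begin

lemma approximable_compl: "approximable M T X A \<Longrightarrow> approximable M T X (space M - A)"
  unfolding approximable_def
proof (intro allI impI)
  fix e :: real
  assume A: "\<forall>e>0. \<exists>k G. prob {x \<in> space M. (x \<in> A) \<noteq> (orbit_word T X k x \<in> G)} < e" and "0 < e"
  then obtain k G where kG: "prob {x \<in> space M. (x \<in> A) \<noteq> (orbit_word T X k x \<in> G)} < e" by blast
  have "{x \<in> space M. (x \<in> space M - A) \<noteq> (orbit_word T X k x \<in> - G)}
      = {x \<in> space M. (x \<in> A) \<noteq> (orbit_word T X k x \<in> G)}" by auto
  with kG have "prob {x \<in> space M. (x \<in> space M - A) \<noteq> (orbit_word T X k x \<in> - G)} < e"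
    by simp
  then show "\<exists>k G. prob {x \<in> space M. (x \<in> space M - A) \<noteq> (orbit_word T X k x \<in> G)} < e"
    by (intro exI)
qed

lemma mismatch_measurable:
  assumes "simple_function M X" and "invariant_measure M T" and "A \<in> sets M"
  shows "{x \<in> space M. (x \<in> A) \<noteq> (orbit_word T X k x \<in> G)} \<in> sets M"
  using simple_function_sets[OF simple_function_Pair[OF simple_function_indicator_pred[OF assms(3)]
        simple_function_orbit_word[OF assms(1,2), of k]], of "{(a, v). a \<noteq> (v \<in> G)}"]
  by simp

lemma approximable_Un:
  assumes X: "simple_function M X" and T: "invariant_measure M T"
    and A: "A \<in> sets M" "approximable M T X A" and B: "B \<in> sets M" "approximable M T X B"
  shows "approximable M T X (A \<union> B)"
  unfolding approximable_def
proof (intro allI impI)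
  fix e :: real assume "0 < e"
  then obtain k G l H where
      k: "prob {x \<in> space M. (x \<in> A) \<noteq> (orbit_word T X k x \<in> G)} < e / 2"
    and l: "prob {x \<in> space M. (x \<in> B) \<noteq> (orbit_word T X l x \<in> H)} < e / 2"
    using A(2) B(2) unfolding approximable_def by (meson half_gt_zero)
  \<comment> \<open>One word of the larger length contains both shorter words as prefixes.\<close>
  let ?K = "{w. take k w \<in> G \<or> take l w \<in> H}"
  have "prob {x \<in> space M. (x \<in> A \<union> B) \<noteq> (orbit_word T X (max k l) x \<in> ?K)}
      \<le> prob ({x \<in> space M. (x \<in> A) \<noteq> (orbit_word T X k x \<in> G)}
          \<union> {x \<in> space M. (x \<in> B) \<noteq> (orbit_word T X l x \<in> H)})"
    by (intro finite_measure_mono sets.Un mismatch_measurable X T A B) (auto simp: take_orbit_word)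
  also have "\<dots> \<le> prob {x \<in> space M. (x \<in> A) \<noteq> (orbit_word T X k x \<in> G)}
      + prob {x \<in> space M. (x \<in> B) \<noteq> (orbit_word T X l x \<in> H)}"
    by (intro measure_Un_le mismatch_measurable X T A B)
  finally show "\<exists>k G. prob {x \<in> space M. (x \<in> A \<union> B) \<noteq> (orbit_word T X k x \<in> G)} < e"
    using k l by (intro exI[of _ "max k l"] exI[of _ ?K]) linarith
qed

lemma approximable_UN:
  assumes X: "simple_function M X" and T: "invariant_measure M T"
    and A: "\<And>i::nat. A i \<in> sets M" "\<And>i. approximable M T X (A i)"
  shows "approximable M T X (\<Union>i. A i)"
  unfolding approximable_def
proof (intro allI impI)
  fix e :: real assume e: "0 < e"
  let ?U = "\<lambda>n. \<Union>i<n. A i"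
  have U: "?U n \<in> sets M" for n using A(1) by auto
  have approx: "approximable M T X (?U n)" for n
  proof (induction n)
    case 0
    show ?case
      unfolding approximable_def by (auto intro!: exI[of _ "{}"])
  next
    case (Suc n)
    have "?U (Suc n) = A n \<union> ?U n" by (auto simp: less_Suc_eq)
    then show ?case using approximable_Un[OF X T A(1,2)[of n] U Suc] by simp
  qed
  have "decseq (\<lambda>n. (\<Union>i. A i) - ?U n)"
    by (intro decseq_SucI) auto
  then have "(\<lambda>n. prob ((\<Union>i. A i) - ?U n)) \<longlonglongrightarrow> prob (\<Inter>n. (\<Union>i. A i) - ?U n)"
    using A(1) U by (intro finite_Lim_measure_decseq) auto
  also have "(\<Inter>n. (\<Union>i. A i) - ?U n) = {}" by auto
  finally obtain n where n: "prob ((\<Union>i. A i) - ?U n) < e / 2"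
    using order_tendstoD(2)[of _ 0 sequentially "e / 2"] e by (auto simp: eventually_sequentially)
  obtain k G where k: "prob {x \<in> space M. (x \<in> ?U n) \<noteq> (orbit_word T X k x \<in> G)} < e / 2"
    using approx[of n] e unfolding approximable_def by (meson half_gt_zero)
  have "prob {x \<in> space M. (x \<in> (\<Union>i. A i)) \<noteq> (orbit_word T X k x \<in> G)}
      \<le> prob (((\<Union>i. A i) - ?U n) \<union> {x \<in> space M. (x \<in> ?U n) \<noteq> (orbit_word T X k x \<in> G)})"
    using A(1) U by (intro finite_measure_mono sets.Un mismatch_measurable X T) auto
  also have "\<dots> \<le> prob ((\<Union>i. A i) - ?U n) + prob {x \<in> space M. (x \<in> ?U n) \<noteq> (orbit_word T X k x \<in> G)}"
    using A(1) U by (intro measure_Un_le mismatch_measurable X T) auto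
  finally show "\<exists>k G. prob {x \<in> space M. (x \<in> (\<Union>i. A i)) \<noteq> (orbit_word T X k x \<in> G)} < e"
    using n k by (intro exI[of _ k] exI[of _ G]) linarith
qed

end

text \<open>Base \<open>exp 1\<close> makes the entropy of \<open>information_space\<close> agree
  with \<open>partition_entropy\<close>.\<close>

locale rlp_system = information_space \<mu> "exp 1"
  for \<mu> :: "'a config measure" +
  fixes \<Lambda> :: "'a set" and W :: "'a config set"
  assumes finite_alphabet: "finite \<Lambda>" and rlp: "rlp_subshift \<Lambda> W"
    and sets_\<mu>: "sets \<mu> = sets (subshift_borel \<Lambda> W)"
    and inv_T: "invariant_measure \<mu> (shift (1, 0))" and inv_S: "invariant_measure \<mu> (shift (0, 1))"
    and atomless: "atomless \<mu>"
begin

abbreviation "T \<equiv> shift (1, 0) :: 'a config \<Rightarrow> 'a config"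
abbreviation "S \<equiv> shift (0, 1) :: 'a config \<Rightarrow> 'a config"
abbreviation "X \<equiv> \<lambda>x :: 'a config. x (0, 0)"

section \<open>Borel structure of the subshift\<close>

lemma closed_W: "closedin (full_shift_topology \<Lambda>) W"
  using rlp by (simp add: rlp_subshift_def subshift_def)

lemma topspace_full: "topspace (full_shift_topology \<Lambda>) = {x. range x \<subseteq> \<Lambda>}"
  by (auto simp: full_shift_topology_def PiE_def Pi_def)

lemma W_alphabet: "x \<in> W \<Longrightarrow> x v \<in> \<Lambda>"
  using closedin_subset[OF closed_W] by (auto simp: topspace_full)

lemma space_\<mu> [simp]: "space \<mu> = W"
  using sets_eq_imp_space_eq[OF sets_\<mu>] by (simp add: subshift_borel_def space_measure_of_conv)

lemma sets_\<mu>_eq: "sets \<mu> = sigma_sets W {U. openin (subtopology (full_shift_topology \<Lambda>) W) U}"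
  unfolding sets_\<mu> subshift_borel_def
  by (rule sets_measure_of) (auto dest!: openin_subset)

lemma closedin_cylinder: "closedin (full_shift_topology \<Lambda>) {x \<in> topspace (full_shift_topology \<Lambda>). x v = c}"
proof -
  have "closedin (full_shift_topology \<Lambda>) {x \<in> topspace (full_shift_topology \<Lambda>). x v \<in> {c} \<inter> \<Lambda>}"
    unfolding full_shift_topology_def
    by (rule closedin_continuous_map_preimage[OF continuous_map_product_projection]) auto
  also have "{x \<in> topspace (full_shift_topology \<Lambda>). x v \<in> {c} \<inter> \<Lambda>}
      = {x \<in> topspace (full_shift_topology \<Lambda>). x v = c}"
    by (auto simp: topspace_full)
  finally show ?thesis .
qed

lemma closed_in_sets:
  assumes "closedin (full_shift_topology \<Lambda>) K" and "K \<subseteq> W"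
  shows "K \<in> sets \<mu>"
proof -
  have "openin (subtopology (full_shift_topology \<Lambda>) W) (W - K)"
    using assms closedin_subset_topspace[OF assms(1,2)] closedin_subset[OF closed_W]
    by (simp add: closedin_def Int_absorb1)
  then have "W - K \<in> sets \<mu>"
    unfolding sets_\<mu>_eq by (intro sigma_sets.Basic) simp
  then have "space \<mu> - (W - K) \<in> sets \<mu>"
    by (rule sets.compl_sets)
  then show ?thesis
    using assms(2) by (simp add: double_diff)
qed

lemma cylinder_sets [measurable]: "{x \<in> W. x v = c} \<in> sets \<mu>"
proof (rule closed_in_sets)
  have "{x \<in> W. x v = c} = W \<inter> {x \<in> topspace (full_shift_topology \<Lambda>). x v = c}"
    using W_alphabet by (auto simp: topspace_full)
  then show "closedin (full_shift_topology \<Lambda>) {x \<in> W. x v = c}"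
    using closedin_Int[OF closed_W closedin_cylinder] by simp
qed auto

lemma simple_coordinate: "simple_function \<mu> (\<lambda>x. x v)"
  unfolding simple_function_def
proof (intro conjI ballI)
  show "finite ((\<lambda>x. x v) ` space \<mu>)"
    by (rule finite_subset[OF _ finite_alphabet]) (auto intro: W_alphabet)
  fix c
  have "(\<lambda>x. x v) -` {c} \<inter> space \<mu> = {x \<in> W. x v = c}" by auto
  then show "(\<lambda>x. x v) -` {c} \<inter> space \<mu> \<in> sets \<mu>" by simp
qed

lemma singleton_sets: "x \<in> W \<Longrightarrow> {x} \<in> sets \<mu>"
proof -
  assume "x \<in> W"
  then have "{x} = (\<Inter>v. {y \<in> W. y v = x v})" by (auto simp: fun_eq_iff)
  also have "\<dots> \<in> sets \<mu>" by (intro sets.countable_INT') auto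
  finally show ?thesis .
qed

lemma countable_null: "countable N \<Longrightarrow> N \<subseteq> W \<Longrightarrow> N \<in> null_sets \<mu>"
proof -
  assume N: "countable N" "N \<subseteq> W"
  have "(\<Union>x\<in>N. {x}) \<in> null_sets \<mu>"
    using N atomless by (intro null_sets_UN') (auto simp: atomless_def intro!: null_setsI singleton_sets)
  then show ?thesis by simp
qed

text \<open>A closed set is approximated by the words that occur in it: a point outside
  \<open>K\<close> all of whose words occur in \<open>K\<close> lies in the countable exceptional
  set, which is null. Closed sets generate the Borel sets. The map \<open>i\<close> allows both axes
  to be treated at once.\<close>

lemma generates_if_almost_generated:
  assumes D: "invariant_measure \<mu> D" and i: "\<And>k x. (D ^^ k) x (0, 0) = x (i k)"
    and gen: "almost_generated (range i) W"
  shows "generates \<mu> D X"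
proof -
  note sX = simple_coordinate[of "(0, 0)"]
  define N where "N = {x \<in> W. \<exists>y\<in>W. y \<noteq> x \<and> (\<forall>j\<in>range i. y j = x j)}"
  have N: "N \<in> null_sets \<mu>"
    unfolding N_def by (rule countable_null[OF countable_shared_points[OF gen]]) auto
  have closed: "approximable \<mu> D X K" if K: "closedin (full_shift_topology \<Lambda>) K" "K \<subseteq> W" for K
    unfolding approximable_def
  proof (intro allI impI)
    fix e :: real assume e: "0 < e"
    have K': "K \<in> sets \<mu>" by (rule closed_in_sets[OF K])
    let ?G = "\<lambda>k. orbit_word D X k ` K"
    define A where "A k = {x \<in> W. (x \<in> K) \<noteq> (orbit_word D X k x \<in> ?G k)}" for k
    have A: "A k \<in> sets \<mu>" for k
      using mismatch_measurable[OF sX D K', of k "?G k"] by (simp add: A_def)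
    have A_eq: "A k = {x \<in> W - K. \<exists>y\<in>K. \<forall>j<k. y (i j) = x (i j)}" for k
      by (auto simp: A_def image_iff orbit_word_eq_iff i)
    have "decseq A"
    proof (intro decseq_SucI subsetI)
      fix n x assume "x \<in> A (Suc n)"
      then obtain y where "x \<in> W - K" "y \<in> K" "\<forall>j<Suc n. y (i j) = x (i j)"
        by (auto simp: A_eq)
      then show "x \<in> A n"
        unfolding A_eq by (intro CollectI conjI bexI[of _ y]) auto
    qed
    then have "(\<lambda>k. prob (A k)) \<longlonglongrightarrow> prob (\<Inter>k. A k)"
      using A by (intro finite_Lim_measure_decseq) auto
    moreover have "(\<Inter>k. A k) \<subseteq> N"
    proof
      fix x assume x: "x \<in> (\<Inter>k. A k)"
      \<comment> \<open>The points of \<open>K\<close> matching the first \<open>k\<close> values of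
        \<open>x\<close> form a decreasing sequence of nonempty closed sets. By compactness some
        point lies in all of them and shows that \<open>x\<close> is exceptional.\<close>
      define F where "F k = {y \<in> K. \<forall>j<k. y (i j) = x (i j)}" for k
      have "closedin (full_shift_topology \<Lambda>) (F k)" for k
      proof (induction k)
        case 0
        then show ?case using K by (simp add: F_def)
      next
        case (Suc k)
        have "F (Suc k) = F k \<inter> {y \<in> topspace (full_shift_topology \<Lambda>). y (i k) = x (i k)}"
          using closedin_subset[OF K(1)] by (auto simp: F_def less_Suc_eq)
        then show ?case using closedin_Int[OF Suc closedin_cylinder] by simp
      qed
      moreover have "F k \<noteq> {}" for k using x by (auto simp: A_eq F_def)
      moreover have "decseq F" by (intro decseq_SucI) (auto simp: F_def)
      moreover have "compact_space (full_shift_topology \<Lambda>)"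
        using finite_alphabet
        by (simp add: full_shift_topology_def compact_space_product_topology compact_space_discrete_topology)
      ultimately have "(\<Inter>k. F k) \<noteq> {}"
        by (intro compact_space_imp_nest)
      then obtain y where y: "\<And>k. y \<in> F k" by blast
      then have "y \<in> K" "\<forall>j. y (i j) = x (i j)" by (auto simp: F_def)
      moreover have "x \<in> W" "x \<notin> K" using x by (auto simp: A_eq)
      ultimately show "x \<in> N" using K(2) by (auto simp: N_def)
    qed
    then have "prob (\<Inter>k. A k) = 0"
      using N A by (intro measure_eq_0_null_sets null_sets_subset[OF N]) auto
    ultimately obtain k where "prob (A k) < e"
      using order_tendstoD(2)[of "\<lambda>k. prob (A k)" 0 sequentially e] e by (auto simp: eventually_sequentially)
    then show "\<exists>k G. prob {x \<in> space \<mu>. (x \<in> K) \<noteq> (orbit_word D X k x \<in> G)} < e"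
      by (auto simp: A_def)
  qed
  have "approximable \<mu> D X A \<and> A \<in> sets \<mu>" if "A \<in> sets \<mu>" for A
    using that unfolding sets_\<mu>_eq
  proof (induction rule: sigma_sets.induct)
    case (Basic U)
    then have U: "openin (subtopology (full_shift_topology \<Lambda>) W) U" by simp
    then have UW: "U \<subseteq> W" using openin_subset by fastforce
    have "closedin (subtopology (full_shift_topology \<Lambda>) W) (W - U)"
      using closedin_diff[OF closedin_topspace U] closedin_subset[OF closed_W] by (simp add: Int_absorb1)
    then have "closedin (full_shift_topology \<Lambda>) (W - U)"
      using closedin_closed_subtopology[OF closed_W] by blast
    then have "approximable \<mu> D X (W - U)" by (rule closed) auto
    then have "approximable \<mu> D X (space \<mu> - (W - U))" by (rule approximable_compl)
    then show ?case
      using UW U by (simp add: double_diff sigma_sets.Basic)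
  next
    case Empty
    show ?case unfolding approximable_def by (auto intro!: exI[of _ "{}"] sigma_sets.Empty)
  next
    case (Compl A)
    then show ?case using approximable_compl[of D X A] by (auto intro: sigma_sets.Compl)
  next
    case (Union A)
    then show ?case
      using approximable_UN[OF sX D, of A] by (auto simp: sets_\<mu>_eq intro: sigma_sets.Union)
  qed
  then show ?thesis
    unfolding generates_def by blast
qed

lemma generates_T: "generates \<mu> T X"
  using rlp
  by (intro generates_if_almost_generated[OF inv_T, of "\<lambda>m. (m, 0)"])
    (auto simp: rlp_subshift_def reciprocal_def row_zero_def shift_funpow shift_apply)

lemma generates_S: "generates \<mu> S X"
  using rlp
  by (intro generates_if_almost_generated[OF inv_S, of "\<lambda>m. (0, m)"])
    (auto simp: rlp_subshift_def reciprocal_def column_zero_def shift_funpow shift_apply)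

end

section \<open>The two Pinsker algebras\<close>

context rlp_system
begin

notation entropy_Pow (\<open>\<H>'(_')\<close>) and conditional_entropy_Pow (\<open>\<H>'(_ \<bar> _')\<close>)

lemma T_W: "x \<in> W \<Longrightarrow> T x \<in> W" and S_W: "x \<in> W \<Longrightarrow> S x \<in> W"
  using rlp by (auto simp: rlp_subshift_def subshift_def)

lemma T_measurable [measurable]: "T \<in> measurable \<mu> \<mu>" and S_measurable [measurable]: "S \<in> measurable \<mu> \<mu>"
  using inv_T inv_S by (simp_all add: invariant_measure_def)

lemma iterated_join_zero_partition:
  assumes "\<And>x. x \<in> W \<Longrightarrow> D x \<in> W"
  shows "iterated_join W D (zero_partition W) n = level_sets W (orbit_word D X n)"
  by (rule iterated_join_eq_level_sets[OF assms]) (auto simp: zero_partition_eq_level_sets level_sets_def)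

text \<open>On a fibre of the \<open>E\<close>-word the \<open>D\<close>-word takes at most
  \<open>max_intersections\<close> values, and the logarithm of a subexponential count is eventually
  below any positive multiple of \<open>l\<close>.\<close>

lemma conditional_entropy_words_le:
  assumes D: "invariant_measure \<mu> D" and E: "invariant_measure \<mu> E" and c: "c > 0"
    and sub: "subexponential (\<lambda>l. max_intersections (level_sets W (orbit_word E X (m l))) (level_sets W (orbit_word D X (n l))))"
  shows "\<forall>\<^sub>F l in sequentially. \<H>(orbit_word D X (n l) \<bar> orbit_word E X (m l)) \<le> c * real l"
proof -
  note wD = simple_function_orbit_word[OF simple_coordinate D]
    and wE = simple_function_orbit_word[OF simple_coordinate E]
  note le = conditional_entropy_le_log_max_intersections[OF wD wE, unfolded space_\<mu>]
  note pos = max_intersections_level_sets_pos[OF wD wE, unfolded space_\<mu>]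
  show ?thesis
    using subexponential_ln_le[OF sub pos c]
  proof eventually_elim
    case (elim l)
    then show ?case
      using le[of "(0, 0)" "n l" "(0, 0)" "m l"] by (simp add: log_def)
  qed
qed

lemma commuting_iterates: "(S ^^ i) ((T ^^ j) x) = (T ^^ j) ((S ^^ i) x)"
  by (simp add: shift_funpow shift_shift)

lemma tail_event_imp_zero_entropy_both:
  shows "tail_event \<mu> T A \<Longrightarrow> (\<lambda>k. \<H>(orbit_word S (\<lambda>x. x \<in> A) k) / real k) \<longlonglongrightarrow> 0"
    and "tail_event \<mu> S A \<Longrightarrow> (\<lambda>k. \<H>(orbit_word T (\<lambda>x. x \<in> A) k) / real k) \<longlonglongrightarrow> 0"
proof -
  note sX = simple_coordinate[of "(0, 0)"]
  have "reciprocal W" using rlp by (simp add: rlp_subshift_def)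
  then obtain a :: real where a: "a > 0"
    and HV: "subexponential (\<lambda>l. max_intersections (level_sets W (orbit_word T X (l + 1)))
      (level_sets W (orbit_word S X (nat \<lfloor>a * real l\<rfloor> + 1))))"
    and VH: "subexponential (\<lambda>l. max_intersections (level_sets W (orbit_word S X (nat \<lfloor>a * real l\<rfloor> + 1)))
      (level_sets W (orbit_word T X (l + 1))))"
    by (auto simp: reciprocal_def Let_def iterated_join_zero_partition[OF T_W]
        iterated_join_zero_partition[OF S_W] simp del: One_nat_def)
  \<comment> \<open>The lengths count the partitions in joins over exponents from 0 to
    \<open>l\<close> and from 0 to the integer part of \<open>a * l\<close>, hence the added
    1.\<close>
  define m where "m l = l + 1" for l :: nat
  define n where "n l = nat \<lfloor>a * real l\<rfloor> + 1" for l :: nat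
  have n_ge: "a * real l \<le> real (n l)" and n_le: "real (n l) \<le> a * real l + 1" for l
    using a by (auto simp: n_def of_nat_nat) linarith+
  have m_lim: "filterlim m at_top sequentially"
    unfolding m_def by (rule filterlim_Suc[unfolded Suc_eq_plus1])
  have n_lim: "filterlim n at_top sequentially"
  proof -
    have "filterlim (\<lambda>l. a * real l) at_top sequentially"
      using a by (intro filterlim_tendsto_pos_mult_at_top[OF tendsto_const] filterlim_real_sequentially)
    then have "filterlim (\<lambda>l. real (n l)) at_top sequentially"
      by (rule filterlim_at_top_mono) (simp add: n_ge)
    then show ?thesis
      by (simp add: filterlim_sequentially_iff_filterlim_real)
  qed
  \<comment> \<open>The two lengths are comparable in both directions, which supplies the constant
    \<open>C\<close> for either assignment of the roles of the two maps.\<close>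
  have mn: "real (m l) \<le> (1 / a + 1) * real (n l)" for l
  proof -
    have "real l \<le> (1 / a) * real (n l)" using n_ge[of l] a by (simp add: field_simps)
    moreover have "1 \<le> real (n l)" by (simp add: n_def)
    ultimately show ?thesis by (simp add: m_def algebra_simps)
  qed
  have nm: "real (n l) \<le> (a + 1) * real (m l)" for l
    using n_le[of l] a by (simp add: m_def algebra_simps)
  have bounds:
    "\<forall>\<^sub>F l in sequentially. \<H>(orbit_word S X (n l) \<bar> orbit_word T X (m l)) \<le> c * real l"
    "\<forall>\<^sub>F l in sequentially. \<H>(orbit_word T X (m l) \<bar> orbit_word S X (n l)) \<le> c * real l" if "c > 0" for c
    using conditional_entropy_words_le[OF inv_S inv_T that HV] conditional_entropy_words_le[OF inv_T inv_S that VH]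
    by (simp_all add: m_def n_def)
  \<comment> \<open>Bounds by multiples of \<open>l\<close> are restated relative to the word length
    of the map whose entropy is to vanish.\<close>
  have bounds_n:
    "\<forall>\<^sub>F l in sequentially. \<H>(orbit_word S X (n l) \<bar> orbit_word T X (m l)) \<le> e * real (n l)"
    "\<forall>\<^sub>F l in sequentially. \<H>(orbit_word T X (m l) \<bar> orbit_word S X (n l)) \<le> e * real (n l)" if e: "e > 0" for e
  proof -
    have c: "e * a > 0" using e a by simp
    have le: "(e * a) * real l \<le> e * real (n l)" for l
      using mult_left_mono[OF n_ge[of l], of e] e by (simp add: mult.assoc)
    show "\<forall>\<^sub>F l in sequentially. \<H>(orbit_word S X (n l) \<bar> orbit_word T X (m l)) \<le> e * real (n l)"
      using bounds(1)[OF c] by eventually_elim (rule order_trans[OF _ le])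
    show "\<forall>\<^sub>F l in sequentially. \<H>(orbit_word T X (m l) \<bar> orbit_word S X (n l)) \<le> e * real (n l)"
      using bounds(2)[OF c] by eventually_elim (rule order_trans[OF _ le])
  qed
  have bounds_m:
    "\<forall>\<^sub>F l in sequentially. \<H>(orbit_word S X (n l) \<bar> orbit_word T X (m l)) \<le> e * real (m l)"
    "\<forall>\<^sub>F l in sequentially. \<H>(orbit_word T X (m l) \<bar> orbit_word S X (n l)) \<le> e * real (m l)" if e: "e > 0" for e
  proof -
    have le: "e * real l \<le> e * real (m l)" for l
      using e by (simp add: m_def)
    show "\<forall>\<^sub>F l in sequentially. \<H>(orbit_word S X (n l) \<bar> orbit_word T X (m l)) \<le> e * real (m l)"
      using bounds(1)[OF e] by eventually_elim (rule order_trans[OF _ le])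
    show "\<forall>\<^sub>F l in sequentially. \<H>(orbit_word T X (m l) \<bar> orbit_word S X (n l)) \<le> e * real (m l)"
      using bounds(2)[OF e] by eventually_elim (rule order_trans[OF _ le])
  qed
  show "(\<lambda>k. \<H>(orbit_word S (\<lambda>x. x \<in> A) k) / real k) \<longlonglongrightarrow> 0" if "tail_event \<mu> T A"
    by (rule tail_event_imp_zero_entropy[OF sX inv_T inv_S commuting_iterates generates_T generates_S that
          n_lim m_lim _ mn bounds_n]) (use a in auto)
  show "(\<lambda>k. \<H>(orbit_word T (\<lambda>x. x \<in> A) k) / real k) \<longlonglongrightarrow> 0" if "tail_event \<mu> S A"
    by (rule tail_event_imp_zero_entropy[OF sX inv_S inv_T commuting_iterates[symmetric] generates_S generates_T that
          m_lim n_lim _ nm bounds_m(2,1)]) (use a in auto)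
qed

text \<open>The implications form a cycle: zero \<open>T\<close>-entropy, tail of \<open>T\<close>,
  zero \<open>S\<close>-entropy, tail of \<open>S\<close>, and zero \<open>T\<close>-entropy
  again.\<close>

lemma zero_entropy_iff:
  assumes A: "A \<in> sets \<mu>"
  shows "dynamical_entropy \<mu> T {A, W - A} = 0 \<longleftrightarrow> dynamical_entropy \<mu> S {A, W - A} = 0"
  using dynamical_entropy_eq_0_iff[OF information_space_axioms inv_T A]
    dynamical_entropy_eq_0_iff[OF information_space_axioms inv_S A]
    zero_entropy_imp_tail_event[OF A inv_T] zero_entropy_imp_tail_event[OF A inv_S]
    tail_event_imp_zero_entropy_both[of A]
  by auto

lemma sets_pinsker_eq: "sets (pinsker_algebra \<mu> T) = sets (pinsker_algebra \<mu> S)"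
proof -
  have "{A \<in> sets \<mu>. dynamical_entropy \<mu> T {A, W - A} = 0} = {A \<in> sets \<mu>. dynamical_entropy \<mu> S {A, W - A} = 0}"
    using zero_entropy_iff by blast
  then show ?thesis by (simp add: pinsker_algebra_def)
qed

text \<open>Almost surely the word of an invariant event repeats its first letter, so all word
  entropies are bounded by that of one letter and vanish after division by \<open>k\<close>.\<close>

lemma S_invariant_zero_entropy:
  assumes A: "A \<in> sets \<mu>" and inv: "AE x in \<mu>. S x \<in> A \<longleftrightarrow> x \<in> A"
  shows "(\<lambda>k. \<H>(orbit_word S (\<lambda>x. x \<in> A) k) / real k) \<longlonglongrightarrow> 0"
proof -
  note sA = simple_function_indicator_pred[OF A]
  note wA = simple_function_orbit_word[OF sA inv_S]
  have le: "\<H>(orbit_word S (\<lambda>x. x \<in> A) k) \<le> \<H>(\<lambda>x. x \<in> A)" for k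
  proof -
    have "AE x in \<mu>. \<forall>i. S ((S ^^ i) x) \<in> A \<longleftrightarrow> (S ^^ i) x \<in> A"
      by (intro AE_all_countable[THEN iffD2] allI AE_invariant_measure[OF invariant_measure_funpow[OF inv_S]] inv)
    then have "AE x in \<mu>. orbit_word S (\<lambda>x. x \<in> A) k x = replicate k (x \<in> A)"
    proof eventually_elim
      case (elim x)
      have "(S ^^ i) x \<in> A \<longleftrightarrow> x \<in> A" for i
        by (induction i) (use elim in auto)
      then show ?case by (simp add: orbit_word_def map_replicate_const)
    qed
    then have "\<H>(orbit_word S (\<lambda>x. x \<in> A) k) = \<H>(\<lambda>x. replicate k (x \<in> A))"
      by (intro entropy_cong_AE wA simple_function_compose1[OF sA])
    also have "\<dots> \<le> \<H>(\<lambda>x. x \<in> A)"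
      by (intro entropy_determined sA simple_function_compose1[OF sA]) simp
    finally show ?thesis .
  qed
  obtain h where "0 \<le> h" and h: "(\<lambda>k. \<H>(orbit_word S (\<lambda>x. x \<in> A) k) / real k) \<longlonglongrightarrow> h"
    by (rule entropy_orbit_word_increments[OF sA inv_S])
  have "h \<le> 0"
    by (rule LIMSEQ_le[OF h lim_const_over_n[of "\<H>(\<lambda>x. x \<in> A)"]])
      (intro exI allI impI divide_right_mono le of_nat_0_le_iff)
  with \<open>0 \<le> h\<close> h show ?thesis by simp
qed

lemma S_invariant_in_pinsker:
  assumes A: "A \<in> sets \<mu>" and inv: "AE x in \<mu>. S x \<in> A \<longleftrightarrow> x \<in> A"
  shows "A \<in> sets (pinsker_algebra \<mu> S)"
proof -
  have "dynamical_entropy \<mu> S {A, W - A} = 0"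
    using dynamical_entropy_eq_0_iff[OF information_space_axioms inv_S A] S_invariant_zero_entropy[OF assms] by simp
  moreover have "sets (pinsker_algebra \<mu> S) = sigma_sets W {A \<in> sets \<mu>. dynamical_entropy \<mu> S {A, W - A} = 0}"
    unfolding pinsker_algebra_def space_\<mu>
    by (intro sets_measure_of) (auto dest!: sets.sets_into_space)
  ultimately show ?thesis using A by (auto intro: sigma_sets.Basic)
qed

text \<open>Vertical invariance becomes dependence on \<open>T x\<close> alone: it gives zero
  \<open>S\<close>-entropy, hence a tail event of \<open>S\<close>, hence zero
  \<open>T\<close>-entropy.\<close>

lemma S_invariant_T_factor:
  assumes A: "A \<in> sets \<mu>" and inv: "AE x in \<mu>. S x \<in> A \<longleftrightarrow> x \<in> A"
  shows "\<exists>B\<in>sets \<mu>. AE x in \<mu>. x \<in> A \<longleftrightarrow> T x \<in> B"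
proof -
  have "tail_event \<mu> S A"
    by (rule zero_entropy_imp_tail_event[OF A inv_S S_invariant_zero_entropy[OF assms]])
  then show ?thesis
    by (intro zero_entropy_event_factor[OF A inv_T] tail_event_imp_zero_entropy_both(2))
qed

end

section \<open>Fibres of the horizontal shift\<close>

locale rlp_conditional = rlp_system +
  fixes \<kappa> :: "'a config \<Rightarrow> 'a config measure"
  assumes cond_\<kappa>: "conditional_measures \<mu> (vimage_algebra W T \<mu>) \<kappa>"
begin

declare One_nat_def [simp del]

abbreviation "F \<equiv> vimage_algebra W T \<mu>"

abbreviation "cyl v a \<equiv> {y \<in> W. y v = a}"

sublocale finite_measure_subalgebra \<mu> F
  using cond_\<kappa> by unfold_locales (simp add: conditional_measures_def)

section \<open>Conditional measures given the horizontal shift\<close>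

lemma sets_F: "sets F = {T -` A \<inter> W | A. A \<in> sets \<mu>}"
  using T_W by (intro sets_vimage_algebra2) auto

lemma kernel_measurable [measurable]: "\<kappa> \<in> measurable F (prob_algebra \<mu>)"
  using cond_\<kappa> by (simp add: conditional_measures_def)

lemma kernel:
  assumes "x \<in> W"
  shows prob_space_kernel: "prob_space (\<kappa> x)" and sets_kernel: "sets (\<kappa> x) = sets \<mu>"
    and space_kernel: "space (\<kappa> x) = W"
proof -
  show "prob_space (\<kappa> x)" and *: "sets (\<kappa> x) = sets \<mu>"
    using measurable_space[OF kernel_measurable, of x] assms by (auto simp: space_prob_algebra)
  show "space (\<kappa> x) = W"
    using sets_eq_imp_space_eq[OF *] by simp
qed

lemma measurable_kernel_measure:
  assumes "B \<in> sets \<mu>"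
  shows "(\<lambda>x. measure (\<kappa> x) B) \<in> borel_measurable F"
  using measurable_compose[OF kernel_measurable measurable_measure_prob_algebra[OF assms]] .

lemma measurable_F: "f \<in> measurable F N \<Longrightarrow> f \<in> measurable \<mu> N"
  by (rule measurable_from_subalg[OF subalg])

text \<open>With \<open>h\<close> a conditional probability this evaluates inner products in L2;
  with \<open>h\<close> an indicator it integrates fibre masses over a set of
  \<open>F\<close>.\<close>

lemma integral_kernel_measure:
  fixes h :: "'a config \<Rightarrow> real"
  assumes h: "h \<in> borel_measurable F" and bound: "\<And>x. x \<in> W \<Longrightarrow> \<bar>h x\<bar> \<le> C" and B: "B \<in> sets \<mu>"
  shows "expectation (\<lambda>x. h x * measure (\<kappa> x) B) = expectation (\<lambda>x. h x * indicator B x)"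
proof -
  note hm = measurable_F[OF h]
  have int: "integrable \<mu> (\<lambda>x. h x * indicator B x)"
    using hm B bound
    by (intro integrable_const_bound[where B = "\<bar>C\<bar>"] AE_I2)
       (fastforce simp: indicator_def)+
  have "AE x in \<mu>. measure (\<kappa> x) B = real_cond_exp \<mu> F (indicator B) x"
    using cond_\<kappa> B by (simp add: conditional_measures_def)
  then have "AE x in \<mu>. h x * measure (\<kappa> x) B = h x * real_cond_exp \<mu> F (indicator B) x"
    by eventually_elim simp
  then have "expectation (\<lambda>x. h x * measure (\<kappa> x) B) = expectation (\<lambda>x. h x * real_cond_exp \<mu> F (indicator B) x)"
    using hm measurable_F[OF measurable_kernel_measure[OF B]] by (intro integral_cong_AE) auto
  also have "\<dots> = expectation (\<lambda>x. h x * indicator B x)"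
    using h B by (intro real_cond_exp_intg(2) int) auto
  finally show ?thesis .
qed

lemma kernel_of_F_set:
  assumes B: "B \<in> sets F"
  shows "AE x in \<mu>. measure (\<kappa> x) B = indicator B x"
proof -
  have B': "B \<in> sets \<mu>" using B subalg by (auto simp: subalgebra_def)
  have "AE x in \<mu>. measure (\<kappa> x) B = real_cond_exp \<mu> F (indicator B) x"
    using cond_\<kappa> B' by (simp add: conditional_measures_def)
  moreover have "AE x in \<mu>. real_cond_exp \<mu> F (indicator B) x = indicator B x"
    using B B' by (intro real_cond_exp_F_meas) (auto simp: emeasure_eq_measure)
  ultimately show ?thesis by eventually_elim simp
qed

text \<open>The fibre masses of \<open>N\<close> are nonnegative and integrate to the measure of
  \<open>N\<close>. Exceptional points may thus be ignored inside almost every fibre as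
  well.\<close>

lemma kernel_of_null_set:
  assumes N: "N \<in> null_sets \<mu>"
  shows "AE x in \<mu>. AE y in \<kappa> x. y \<notin> N"
proof -
  have N': "N \<in> sets \<mu>" using N by auto
  have "expectation (\<lambda>x. measure (\<kappa> x) N) = expectation (\<lambda>x. indicator N x)"
    using integral_kernel_measure[of "\<lambda>_. 1" 1 N] N' by simp
  also have "\<dots> = 0" using N sets.Int_space_eq2[OF N'] by (simp add: measure_eq_0_null_sets)
  finally have "expectation (\<lambda>x. measure (\<kappa> x) N) = 0" .
  moreover have "integrable \<mu> (\<lambda>x. measure (\<kappa> x) N)"
    using measurable_F[OF measurable_kernel_measure[OF N']] prob_space.prob_le_1[OF prob_space_kernel]
    by (intro integrable_const_bound[where B = 1]) auto
  ultimately have "AE x in \<mu>. measure (\<kappa> x) N = 0"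
    by (subst (asm) integral_nonneg_eq_0_iff_AE) auto
  then show ?thesis
    using AE_space
  proof eventually_elim
    case (elim x)
    then interpret \<kappa>: prob_space "\<kappa> x" by (intro prob_space_kernel) simp
    have "N \<in> null_sets (\<kappa> x)"
      using elim N' sets_kernel[of x] by (intro null_setsI) (auto simp: \<kappa>.emeasure_eq_measure)
    then show ?case by (rule AE_not_in)
  qed
qed

lemma cylinder_T_sets_F: "{y \<in> W. T y v = c} \<in> sets F"
proof -
  have "{y \<in> W. T y v = c} = T -` cyl v c \<inter> W" using T_W by auto
  then show ?thesis using in_vimage_algebra[OF cylinder_sets[of v c], of T W] by simp
qed

text \<open>Countably many events on the letters of \<open>T y\<close> determine \<open>T y\<close>.
  Each lies in \<open>F\<close> and so has fibre mass 0 or 1 according to \<open>x\<close>, and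
  countably many null sets are discarded together.\<close>

lemma kernel_fibre: "AE x in \<mu>. AE y in \<kappa> x. T y = T x"
proof -
  have "AE x in \<mu>. \<forall>v. \<forall>c\<in>\<Lambda>. measure (\<kappa> x) {y \<in> W. T y v = c} = indicator {y \<in> W. T y v = c} x"
    unfolding AE_all_countable
    by (intro allI AE_finite_allI finite_alphabet kernel_of_F_set cylinder_T_sets_F)
  then show ?thesis
    using AE_space
  proof eventually_elim
    case (elim x)
    then have x: "x \<in> W" by simp
    interpret \<kappa>: prob_space "\<kappa> x" by (rule prob_space_kernel[OF x])
    have "AE y in \<kappa> x. T y v = T x v" for v
    proof -
      have "measure (\<kappa> x) {y \<in> W. T y v = T x v} = 1"
        using bspec[OF spec[OF elim(1), of v] W_alphabet[OF T_W[OF x], of v]] x by simp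
      then have "AE y in \<kappa> x. y \<in> {y \<in> W. T y v = T x v}" by (rule \<kappa>.AE_prob_1)
      then show ?thesis by eventually_elim simp
    qed
    then have "AE y in \<kappa> x. \<forall>v. T y v = T x v" by (simp add: AE_all_countable)
    then show ?case by eventually_elim auto
  qed
qed

section \<open>Points of a fibre and their letters\<close>

lemma shared_row_null: "shared_row_set W \<in> null_sets \<mu>"
proof (rule countable_null)
  show "countable (shared_row_set W)"
    using countable_shared_points[of row_zero W] rlp
    by (simp add: shared_row_set_def rlp_subshift_def reciprocal_def)
qed (auto simp: shared_row_set_def)

lemma T_eq_iff_row:
  assumes "T x = T y"
  shows "m \<ge> 1 \<Longrightarrow> x (m, n) = y (m, n)"
  using fun_cong[OF assms, of "(m - 1, n)"] by (simp add: shift_apply)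

text \<open>Equal images under \<open>T\<close> fix everything outside column zero. With the letter
  at the origin the zero rows agree, and the zero row of \<open>x\<close> belongs to no other
  point.\<close>

lemma eq_if_same_shift_and_origin:
  assumes x: "x \<in> W - shared_row_set W" and y: "y \<in> W" and "T y = T x" and "y (0, 0) = x (0, 0)"
  shows "y = x"
proof -
  have "y (m, 0) = x (m, 0)" for m
    using T_eq_iff_row[OF assms(3), of m 0] assms(4) by (cases m) auto
  then show ?thesis
    using x y by (auto simp: shared_row_set_def row_zero_def)
qed

lemma eq_if_same_shift_and_above_origin:
  assumes x: "x \<in> W - shared_row_set W" and y: "y \<in> W - shared_row_set W"
    and T: "T y = T x" and above: "y (0, 1) = x (0, 1)"
  shows "y = x"
proof -
  have "left_permutative W" using rlp by (simp add: rlp_subshift_def)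
  then have "y (0, 0) = x (0, 0)"
    using x y above T_eq_iff_row[OF T, of _ 0] unfolding left_permutative_def by blast
  then show ?thesis using eq_if_same_shift_and_origin[OF x _ T] y by blast
qed

text \<open>\<open>P\<close> and \<open>Q\<close> are the fibre laws of the letter at the origin and
  of the letter above it; \<open>f\<close> is almost surely either law evaluated at the point's own
  letter, see \<open>f_eq\<close>.\<close>

definition "f x = measure (\<kappa> x) {x}"
definition "P a x = measure (\<kappa> x) (cyl (0, 0) a)"
definition "Q a x = measure (\<kappa> x) (cyl (0, 1) a)"

text \<open>On the fibre of \<open>x\<close> the singleton agrees almost surely with a cylinder at
  the origin and with one above it. Left permutativity compares two points outside the exceptional
  set, so this null set is removed inside the fibre too.\<close>

lemma f_eq: "AE x in \<mu>. f x = P (x (0, 0)) x \<and> f x = Q (x (0, 1)) x"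
  using kernel_fibre kernel_of_null_set[OF shared_row_null] AE_not_in[OF shared_row_null] AE_space
proof eventually_elim
  case (elim x)
  then have x: "x \<in> W - shared_row_set W" and xW: "x \<in> W" by auto
  interpret \<kappa>: prob_space "\<kappa> x" by (rule prob_space_kernel[OF xW])
  have sing: "{x} \<in> sets (\<kappa> x)" and cyl: "cyl v a \<in> sets (\<kappa> x)" for v a
    using xW by (simp_all add: sets_kernel singleton_sets cylinder_sets)
  have W: "AE y in \<kappa> x. y \<in> W"
    using AE_space[of "\<kappa> x"] space_kernel[OF xW] by simp
  have "AE y in \<kappa> x. y \<in> {x} \<longleftrightarrow> y \<in> cyl (0, 0) (x (0, 0))"
    using elim(1) W by eventually_elim (use eq_if_same_shift_and_origin[OF x] xW in auto)
  then have "f x = P (x (0, 0)) x"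
    unfolding f_def P_def by (rule measure_eq_AE) (rule sing cyl)+
  moreover have "AE y in \<kappa> x. y \<in> {x} \<longleftrightarrow> y \<in> cyl (0, 1) (x (0, 1))"
    using elim(1,2) W by eventually_elim (use eq_if_same_shift_and_above_origin[OF x] xW in auto)
  then have "f x = Q (x (0, 1)) x"
    unfolding f_def Q_def by (rule measure_eq_AE) (rule sing cyl)+
  ultimately show ?case by simp
qed

lemma P_measurable: "P a \<in> borel_measurable F" and Q_measurable: "Q a \<in> borel_measurable F"
  unfolding P_def Q_def by (intro measurable_kernel_measure cylinder_sets)+

lemma P_bounds: "x \<in> W \<Longrightarrow> \<bar>P a x\<bar> \<le> 1" and Q_bounds: "x \<in> W \<Longrightarrow> \<bar>Q a x\<bar> \<le> 1"
  using prob_space.prob_le_1[OF prob_space_kernel] by (auto simp: P_def Q_def)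

text \<open>\<open>S\<close> commutes with \<open>T\<close>, so it pulls preimages under
  \<open>T\<close> back to preimages under \<open>T\<close>.\<close>

lemma S_measurable_F: "S \<in> measurable F F"
proof (rule measurableI)
  fix x assume "x \<in> space F"
  then show "S x \<in> space F" using S_W by simp
next
  fix A assume "A \<in> sets F"
  then obtain B where B: "B \<in> sets \<mu>" and A: "A = T -` B \<inter> W" unfolding sets_F by blast
  have "S -` A \<inter> space F = T -` (S -` B \<inter> W) \<inter> W"
    using S_W T_W by (auto simp: A shift_shift)
  moreover have "S -` B \<inter> W \<in> sets \<mu>" using measurable_sets[OF S_measurable B] by simp
  ultimately show "S -` A \<inter> space F \<in> sets F" using in_vimage_algebra[of "S -` B \<inter> W" \<mu> T W] by simp
qed

lemma expectation_S: "g \<in> borel_measurable \<mu> \<Longrightarrow> expectation (\<lambda>x. g (S x)) = expectation g"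
  for g :: "'a config \<Rightarrow> real"
  using integral_distr[OF S_measurable, of g] inv_S by (simp add: invariant_measure_def)

text \<open>\<open>P a \<circ> S\<close> is the conditional probability of \<open>cyl (0, 1) a\<close> on the smaller \<open>\<sigma>\<close>-algebra
  \<open>S\<^sup>-\<^sup>1 F\<close>, so it is an orthogonal projection of \<open>Q a\<close>; summed over \<open>a\<close>, the two have the same
  \<open>L\<^sup>2\<close> norm, namely the integral of \<open>f\<close>.\<close>

lemma Q_eq_P_S: "AE x in \<mu>. \<forall>a\<in>\<Lambda>. Q a x = P a (S x)"
proof -
  define R where "R a x = P a (S x)" for a x
  have Rm: "R a \<in> borel_measurable F" for a
    unfolding R_def by (rule measurable_compose[OF S_measurable_F P_measurable])
  have Rb: "x \<in> W \<Longrightarrow> \<bar>R a x\<bar> \<le> 1" for x a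
    unfolding R_def by (intro P_bounds S_W)
  note [measurable] = measurable_F[OF Rm] measurable_F[OF P_measurable] measurable_F[OF Q_measurable]
  have int: "integrable \<mu> (\<lambda>x. g x * h x)"
    if "g \<in> borel_measurable \<mu>" "h \<in> borel_measurable \<mu>" "\<And>x. x \<in> W \<Longrightarrow> \<bar>g x\<bar> \<le> 1" "\<And>x. x \<in> W \<Longrightarrow> \<bar>h x\<bar> \<le> 1"
    for g h :: "'a config \<Rightarrow> real"
    using that by (intro integrable_const_bound[where B = 1] AE_I2) (auto simp: abs_mult intro: mult_le_one)
  have int_ind: "integrable \<mu> (\<lambda>x. g x * indicator (cyl v a) x)"
    if "g \<in> borel_measurable \<mu>" "\<And>x. x \<in> W \<Longrightarrow> \<bar>g x\<bar> \<le> 1" for g :: "'a config \<Rightarrow> real" and v a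
    using that by (intro int) auto
  have pick: "(\<Sum>a\<in>\<Lambda>. g a * indicator (cyl v a) x) = g (x v)" if "x \<in> W" for g :: "'a \<Rightarrow> real" and v x
  proof -
    have "(\<Sum>a\<in>\<Lambda>. g a * indicator (cyl v a) x) = (\<Sum>a\<in>\<Lambda>. if x v = a then g a else 0)"
      using that by (intro sum.cong) auto
    then show ?thesis using W_alphabet[OF that] finite_alphabet by simp
  qed
  have fm: "AE x in \<mu>. f x = P (x (0, 0)) x" "AE x in \<mu>. f x = Q (x (0, 1)) x"
    using f_eq by (eventually_elim, simp)+
  have QQ: "expectation (\<lambda>x. Q a x * Q a x) = expectation (\<lambda>x. Q a x * indicator (cyl (0, 1) a) x)" for a
    using integral_kernel_measure[OF Q_measurable[of a] Q_bounds cylinder_sets[of "(0, 1)" a]] by (simp add: Q_def)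
  have PP: "expectation (\<lambda>x. P a x * P a x) = expectation (\<lambda>x. P a x * indicator (cyl (0, 0) a) x)" for a
    using integral_kernel_measure[OF P_measurable[of a] P_bounds cylinder_sets[of "(0, 0)" a]] by (simp add: P_def)
  have RR: "expectation (\<lambda>x. R a x * R a x) = expectation (\<lambda>x. P a x * indicator (cyl (0, 0) a) x)" for a
    using expectation_S[of "\<lambda>x. P a x * P a x"] PP[of a] by (simp add: R_def)
  \<comment> \<open>\<open>R a\<close> is measurable on \<open>F\<close>, so \<open>Q a\<close> may
    be replaced by the indicator of its cylinder. This cylinder is the \<open>S\<close>-preimage of
    \<open>cyl (0, 0) a\<close>, and invariance removes \<open>S\<close>.\<close>
  have RQ: "expectation (\<lambda>x. R a x * Q a x) = expectation (\<lambda>x. P a x * indicator (cyl (0, 0) a) x)" for a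
  proof -
    have "expectation (\<lambda>x. R a x * Q a x) = expectation (\<lambda>x. R a x * indicator (cyl (0, 1) a) x)"
      using integral_kernel_measure[OF Rm[of a] Rb cylinder_sets[of "(0, 1)" a]] by (simp add: Q_def)
    also have "\<dots> = expectation (\<lambda>x. P a (S x) * indicator (cyl (0, 0) a) (S x))"
      using S_W by (intro Bochner_Integration.integral_cong) (auto simp: R_def indicator_def shift_apply)
    also have "\<dots> = expectation (\<lambda>x. P a x * indicator (cyl (0, 0) a) x)"
      by (intro expectation_S) simp
    finally show ?thesis .
  qed
  have "(\<Sum>a\<in>\<Lambda>. expectation (\<lambda>x. (Q a x - R a x)\<^sup>2))
      = (\<Sum>a\<in>\<Lambda>. expectation (\<lambda>x. Q a x * Q a x) - 2 * expectation (\<lambda>x. R a x * Q a x) + expectation (\<lambda>x. R a x * R a x))"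
  proof (intro sum.cong refl)
    fix a
    have "expectation (\<lambda>x. (Q a x - R a x)\<^sup>2) = expectation (\<lambda>x. Q a x * Q a x - 2 * (R a x * Q a x) + R a x * R a x)"
      by (simp add: power2_eq_square algebra_simps)
    also have "\<dots> = expectation (\<lambda>x. Q a x * Q a x) - 2 * expectation (\<lambda>x. R a x * Q a x) + expectation (\<lambda>x. R a x * R a x)"
      using int[of "Q a" "Q a"] int[of "R a" "Q a"] int[of "R a" "R a"] Q_bounds Rb by simp
    finally show "expectation (\<lambda>x. (Q a x - R a x)\<^sup>2) = \<dots>" .
  qed
  \<comment> \<open>The mixed terms and the squares of \<open>R a\<close> agree letter by letter;
    the two sums left over are both the integral of \<open>f\<close>.\<close>
  also have "\<dots> = (\<Sum>a\<in>\<Lambda>. expectation (\<lambda>x. Q a x * indicator (cyl (0, 1) a) x))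
      - (\<Sum>a\<in>\<Lambda>. expectation (\<lambda>x. P a x * indicator (cyl (0, 0) a) x))"
    by (simp add: QQ RQ RR sum_subtractf)
  also have "\<dots> = expectation (\<lambda>x. \<Sum>a\<in>\<Lambda>. Q a x * indicator (cyl (0, 1) a) x)
      - expectation (\<lambda>x. \<Sum>a\<in>\<Lambda>. P a x * indicator (cyl (0, 0) a) x)"
    using int_ind[OF measurable_F[OF Q_measurable] Q_bounds] int_ind[OF measurable_F[OF P_measurable] P_bounds]
    by (simp add: Bochner_Integration.integral_sum)
  also have "\<dots> = 0"
  proof -
    have "AE x in \<mu>. (\<Sum>a\<in>\<Lambda>. Q a x * indicator (cyl (0, 1) a) x) = (\<Sum>a\<in>\<Lambda>. P a x * indicator (cyl (0, 0) a) x)"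
      using fm AE_space
    proof eventually_elim
      case (elim x)
      then show ?case
        using pick[of x "\<lambda>a. Q a x" "(0, 1)"] pick[of x "\<lambda>a. P a x" "(0, 0)"] by simp
    qed
    then have "expectation (\<lambda>x. \<Sum>a\<in>\<Lambda>. Q a x * indicator (cyl (0, 1) a) x)
      = expectation (\<lambda>x. \<Sum>a\<in>\<Lambda>. P a x * indicator (cyl (0, 0) a) x)"
      by (intro integral_cong_AE) auto
    then show ?thesis by simp
  qed
  finally have "\<forall>a\<in>\<Lambda>. expectation (\<lambda>x. (Q a x - R a x)\<^sup>2) = 0"
    using finite_alphabet by (subst (asm) sum_nonneg_eq_0_iff) auto
  moreover have "integrable \<mu> (\<lambda>x. (Q a x - R a x)\<^sup>2)" for a
    using int[of "Q a" "Q a"] int[of "R a" "Q a"] int[of "R a" "R a"] Q_bounds Rb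
    by (simp add: power2_diff) (simp add: power2_eq_square ac_simps)
  ultimately have "AE x in \<mu>. (Q a x - R a x)\<^sup>2 = 0" if "a \<in> \<Lambda>" for a
    using that by (subst integral_nonneg_eq_0_iff_AE[symmetric]) auto
  then show ?thesis
    unfolding R_def by (intro AE_finite_allI finite_alphabet) auto
qed

section \<open>Invariance and measurability of the fibre mass\<close>

lemma f_invariant: "AE x in \<mu>. f (S x) = f x"
proof -
  have "AE x in \<mu>. f (S x) = P (x (0, 1)) (S x)"
    using AE_invariant_measure[OF inv_S f_eq] by eventually_elim (simp add: shift_apply)
  then show ?thesis
    using f_eq Q_eq_P_S AE_space by eventually_elim (use W_alphabet in auto)
qed

text \<open>The measured set \<open>{x}\<close> moves with \<open>x\<close>, so measurability of the
  diagonal in the product is used. It is a countable intersection, over positions, of finite unions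
  of squares, over letters.\<close>

lemma f_measurable: "f \<in> borel_measurable \<mu>"
proof -
  have "(SIGMA x:W. {x}) = (\<Inter>v. \<Union>a\<in>\<Lambda>. cyl v a \<times> cyl v a)"
    using W_alphabet by (auto simp: fun_eq_iff)
  also have "\<dots> \<in> sets (\<mu> \<Otimes>\<^sub>M \<mu>)"
    by (intro sets.countable_INT' sets.finite_UN finite_alphabet pair_measureI cylinder_sets) (auto intro!: sets.finite_UN finite_alphabet pair_measureI cylinder_sets)
  finally show ?thesis
    unfolding f_def
    by (intro measure_measurable_prob_algebra2[of \<mu> "\<lambda>x. {x}" \<mu>] measurable_F[OF kernel_measurable]) simp
qed

lemma f_superlevel: "{x \<in> W. c < f x} \<in> sets \<mu>"
  and f_superlevel_invariant: "AE x in \<mu>. S x \<in> {x \<in> W. c < f x} \<longleftrightarrow> x \<in> {x \<in> W. c < f x}"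
proof -
  show "{x \<in> W. c < f x} \<in> sets \<mu>"
    using f_measurable unfolding borel_measurable_iff_greater by simp
  show "AE x in \<mu>. S x \<in> {x \<in> W. c < f x} \<longleftrightarrow> x \<in> {x \<in> W. c < f x}"
    using f_invariant AE_space by eventually_elim (simp add: S_W)
qed

lemma f_pinsker_measurable:
  "f \<in> borel_measurable (pinsker_algebra \<mu> S)" "f \<in> borel_measurable (pinsker_algebra \<mu> T)"
proof -
  have sp: "space (pinsker_algebra \<mu> D) = W" for D
    by (simp add: pinsker_algebra_def space_measure_of_conv)
  show S: "f \<in> borel_measurable (pinsker_algebra \<mu> S)"
    unfolding borel_measurable_iff_greater sp
    by (intro allI S_invariant_in_pinsker f_superlevel f_superlevel_invariant)
  show "f \<in> borel_measurable (pinsker_algebra \<mu> T)"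
    using S sets_pinsker_eq by (simp add: measurable_def sp)
qed

text \<open>The superlevel sets of \<open>f\<close> are preimages under \<open>T\<close> modulo null
  sets, so on a fibre the condition \<open>c < P a x\<close> has the same answer for all letters
  \<open>a\<close> of positive mass; rational \<open>c\<close> separate unequal masses.\<close>

lemma positive_fibre_masses_equal: "AE x in \<mu>. \<forall>a\<in>\<Lambda>. \<forall>b\<in>\<Lambda>. 0 < P a x \<and> 0 < P b x \<longrightarrow> P a x = P b x"
proof -
  have "\<forall>c. \<exists>B. B \<in> sets \<mu> \<and> (AE x in \<mu>. x \<in> {x \<in> W. c < f x} \<longleftrightarrow> T x \<in> B)"
    by (intro allI S_invariant_T_factor[unfolded Bex_def] f_superlevel f_superlevel_invariant)
  from choice[OF this] obtain B where
    *: "\<forall>c. B c \<in> sets \<mu> \<and> (AE x in \<mu>. x \<in> {x \<in> W. c < f x} \<longleftrightarrow> T x \<in> B c)"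
    by (rule exE)
  have B: "B c \<in> sets \<mu>" and AEB: "AE x in \<mu>. x \<in> {x \<in> W. c < f x} \<longleftrightarrow> T x \<in> B c" for c
    using *[rule_format, of c] by (rule conjunct1, rule conjunct2)
  have main: "AE x in \<mu>. P a x = 0 \<or> (c < P a x \<longleftrightarrow> T x \<in> B c)" if "a \<in> \<Lambda>" for a c
  proof -
    \<comment> \<open>On \<open>E\<close> the two sides of the claimed equivalence disagree. As
      \<open>E\<close> lies in \<open>F\<close>, the integral of \<open>P a\<close> over it is the
      measure of its part with letter \<open>a\<close> at the origin; there \<open>P a\<close>
      equals \<open>f\<close> almost surely, so that part is null.\<close>
    define E where "E = {x \<in> W. (c < P a x) \<noteq> (T x \<in> B c)}"
    have TB: "{x \<in> W. T x \<in> B c} \<in> sets F"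
      using in_vimage_algebra[OF B[of c], of T W] by (simp add: vimage_def Int_def conj_commute)
    have PB: "{x \<in> W. c < P a x} \<in> sets F"
      using P_measurable[of a] unfolding borel_measurable_iff_greater by simp
    have "E = ({x \<in> W. c < P a x} - {x \<in> W. T x \<in> B c}) \<union> ({x \<in> W. T x \<in> B c} - {x \<in> W. c < P a x})"
      by (auto simp: E_def)
    then have E: "E \<in> sets F" using TB PB by auto
    have E': "E \<in> sets \<mu>" using E subalg by (auto simp: subalgebra_def)
    have "AE x in \<mu>. indicator E x * indicator (cyl (0, 0) a) x = (0 :: real)"
      using AEB[of c] f_eq AE_space by eventually_elim (auto simp: E_def indicator_def)
    then have "expectation (\<lambda>x. indicator E x * indicator (cyl (0, 0) a) x) = (0 :: real)"
      by (rule integral_eq_zero_AE)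
    then have "expectation (\<lambda>x. indicator E x * P a x) = 0"
      using integral_kernel_measure[of "indicator E" 1 "cyl (0, 0) a"] E by (simp add: P_def)
    moreover have "integrable \<mu> (\<lambda>x. indicator E x * P a x)"
      using E' measurable_F[OF P_measurable[of a]] P_bounds
      by (intro integrable_const_bound[where B = 1]) (auto simp: indicator_def)
    ultimately have "AE x in \<mu>. indicator E x * P a x = 0"
      by (subst (asm) integral_nonneg_eq_0_iff_AE) (auto simp: P_def)
    then show ?thesis
      using AE_space by eventually_elim (auto simp: E_def indicator_def split: if_splits)
  qed
  have "AE x in \<mu>. \<forall>a\<in>\<Lambda>. \<forall>c\<in>\<rat>. P a x = 0 \<or> (c < P a x \<longleftrightarrow> T x \<in> B c)"
    by (intro AE_finite_allI finite_alphabet AE_ball_countable[THEN iffD2] countable_rat ballI main)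
  then show ?thesis
  proof eventually_elim
    case (elim x)
    have "\<not> P a x < P b x" if "a \<in> \<Lambda>" "b \<in> \<Lambda>" "0 < P a x" "0 < P b x" for a b
    proof
      assume "P a x < P b x"
      then obtain c where c: "c \<in> \<rat>" "P a x < c" "c < P b x" using Rats_dense_in_real by blast
      show False
        using bspec[OF bspec[OF elim that(1)] c(1)] bspec[OF bspec[OF elim that(2)] c(1)] c that by auto
    qed
    then show ?case by (meson linorder_neqE)
  qed
qed

text \<open>The set \<open>L\<close> is the support of the fibre law of the origin letter; equal
  masses with sum 1 give \<open>1 / card L\<close> to each of its letters.\<close>

lemma kernel_uniform:
  "AE x in \<mu>. \<exists>L. L \<subseteq> \<Lambda> \<and> L \<noteq> {} \<and>
     distr (\<kappa> x) (count_space \<Lambda>) X = uniform_measure (count_space \<Lambda>) L"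
  using positive_fibre_masses_equal AE_space
proof eventually_elim
  case (elim x)
  then have x: "x \<in> W" by simp
  interpret \<kappa>: prob_space "\<kappa> x" by (rule prob_space_kernel[OF x])
  define L where "L = {a \<in> \<Lambda>. 0 < P a x}"
  have finL: "finite L" using finite_alphabet by (simp add: L_def)
  have nn: "0 \<le> P a x" for a by (simp add: P_def)
  have Xm: "X \<in> measurable (\<kappa> x) (count_space \<Lambda>)"
  proof (rule measurableI)
    fix A assume "A \<in> sets (count_space \<Lambda>)"
    have "X -` A \<inter> space \<mu> \<in> sets \<mu>"
      using simple_functionD(2)[OF simple_coordinate] .
    then show "X -` A \<inter> space (\<kappa> x) \<in> sets (\<kappa> x)"
      using sets_kernel[OF x] space_kernel[OF x] by simp
  qed (use space_kernel[OF x] W_alphabet in auto)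
  have sum1: "(\<Sum>a\<in>\<Lambda>. P a x) = 1"
  proof -
    have "(\<Sum>a\<in>\<Lambda>. P a x) = measure (\<kappa> x) (\<Union>a\<in>\<Lambda>. cyl (0, 0) a)"
      unfolding P_def
    proof (rule \<kappa>.finite_measure_finite_Union[symmetric, OF finite_alphabet])
      show "(\<lambda>a. cyl (0, 0) a) ` \<Lambda> \<subseteq> sets (\<kappa> x)"
        unfolding sets_kernel[OF x] by (intro image_subsetI cylinder_sets)
      show "disjoint_family_on (\<lambda>a. cyl (0, 0) a) \<Lambda>"
        unfolding disjoint_family_on_def by blast
    qed
    also have "(\<Union>a\<in>\<Lambda>. cyl (0, 0) a) = space (\<kappa> x)"
      using space_kernel[OF x] W_alphabet by auto
    finally show ?thesis by (simp add: \<kappa>.prob_space)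
  qed
  have "(\<Sum>a\<in>\<Lambda>. P a x) = (\<Sum>a\<in>L. P a x)"
    using finite_alphabet nn by (intro sum.mono_neutral_right) (auto simp: L_def order.antisym not_less)
  with sum1 have sumL: "(\<Sum>a\<in>L. P a x) = 1" by simp
  then have "L \<noteq> {}" by auto
  have PL: "P a x = 1 / card L" if "a \<in> L" for a
  proof -
    have "(\<Sum>b\<in>L. P b x) = (\<Sum>b\<in>L. P a x)"
      using elim(1) that by (intro sum.cong) (auto simp: L_def)
    then have "real (card L) * P a x = 1" using sumL by simp
    then show ?thesis using \<open>L \<noteq> {}\<close> finL by (simp add: field_simps)
  qed
  have "distr (\<kappa> x) (count_space \<Lambda>) X = uniform_measure (count_space \<Lambda>) L"
  proof (rule measure_eqI_finite[of _ \<Lambda>])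
    fix a assume a: "a \<in> \<Lambda>"
    have "emeasure (distr (\<kappa> x) (count_space \<Lambda>) X) {a} = emeasure (\<kappa> x) (X -` {a} \<inter> space (\<kappa> x))"
      using a by (intro emeasure_distr Xm) simp
    also have "X -` {a} \<inter> space (\<kappa> x) = cyl (0, 0) a"
      using space_kernel[OF x] by auto
    also have "emeasure (\<kappa> x) (cyl (0, 0) a) = ennreal (P a x)"
      by (simp add: \<kappa>.emeasure_eq_measure P_def)
    also have "\<dots> = emeasure (uniform_measure (count_space \<Lambda>) L) {a}"
    proof (cases "a \<in> L")
      case True
      then have "L \<inter> {a} = {a}" by auto
      moreover have "L \<subseteq> \<Lambda>" by (auto simp: L_def)
      moreover have "0 < card L" using True finL by (auto simp: card_gt_0_iff)
      ultimately show ?thesis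
        using a finL PL[OF True]
        by (simp add: emeasure_count_space divide_ennreal ennreal_of_nat_eq_real_of_nat flip: ennreal_1)
    next
      case False
      then have "P a x = 0" using a nn[of a] by (auto simp: L_def)
      moreover have "L \<inter> {a} = {}" using False by auto
      moreover have "L \<subseteq> \<Lambda>" by (auto simp: L_def)
      ultimately show ?thesis using a by simp
    qed
    finally show "emeasure (distr (\<kappa> x) (count_space \<Lambda>) X) {a} = emeasure (uniform_measure (count_space \<Lambda>) L) {a}" .
  qed (simp_all add: finite_alphabet)
  then show ?case using \<open>L \<noteq> {}\<close> by (intro exI[of _ L]) (auto simp: L_def)
qed

end

theorem theorem7p8:
  fixes \<Lambda> :: "'a set" and W :: "'a config set" and \<mu> :: "'a config measure"
    and \<kappa> :: "'a config \<Rightarrow> 'a config measure"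
  assumes "finite \<Lambda>"
    and "rlp_subshift \<Lambda> W"
    and "prob_space \<mu>" and "sets \<mu> = sets (subshift_borel \<Lambda> W)"
    and "invariant_measure \<mu> (shift (1, 0))" and "invariant_measure \<mu> (shift (0, 1))"
    and "atomless \<mu>"
    and "conditional_measures \<mu> (vimage_algebra (space \<mu>) (shift (1, 0)) \<mu>) \<kappa>"
  shows "(AE x in \<mu>. measure (\<kappa> (shift (0, 1) x)) {shift (0, 1) x} = measure (\<kappa> x) {x})
    \<and> sets (pinsker_algebra \<mu> (shift (1, 0))) = sets (pinsker_algebra \<mu> (shift (0, 1)))
    \<and> (\<lambda>x. measure (\<kappa> x) {x}) \<in> borel_measurable (pinsker_algebra \<mu> (shift (1, 0)))
    \<and> (\<lambda>x. measure (\<kappa> x) {x}) \<in> borel_measurable (pinsker_algebra \<mu> (shift (0, 1)))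
    \<and> (AE x in \<mu>. \<exists>L. L \<subseteq> \<Lambda> \<and> L \<noteq> {} \<and>
          distr (\<kappa> x) (count_space \<Lambda>) (\<lambda>y. y (0, 0)) = uniform_measure (count_space \<Lambda>) L)"
proof -
  interpret prob_space \<mu> by fact
  interpret rlp_system \<mu> \<Lambda> W
    by unfold_locales (use assms in simp_all)
  interpret rlp_conditional \<mu> \<Lambda> W \<kappa>
    by unfold_locales (use assms(8) in simp)
  have f: "(\<lambda>x. measure (\<kappa> x) {x}) = f" by (simp add: f_def fun_eq_iff)
  show ?thesis
    unfolding f using f_invariant sets_pinsker_eq f_pinsker_measurable kernel_uniform
    by (simp add: f_def)
qed

end
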